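(* Let $X$ be a subshift and let $R$ be a field. For a class $[q]\in\mathcal Q_X/{\sim}$, the two-sided ideal $\langle p_{\{q\}}\rangle$ of $\widetilde{\mathcal A}_R(X)$ does not depend on the chosen representative; denote it by $\langle p_{[q]}\rangle$. Then $$\mathrm{Soc}\big(\widetilde{\mathcal A}_R(X)\big)=\bigoplus_{[q]\in\mathcal Q_X/\sim}\langle p_{[q]}\rangle ,$$ an internal direct sum of two-sided ideals.
   Context: Notation: $\mathbb N=\{0,1,2,\dots\}$. Let $\mathfrak A$ be a nonempty set (the alphabet) and let $\mathfrak A^*$ be the set of finite words over $\mathfrak A$, including the empty word $\omega$. For a nonempty word $\beta$, $\beta^\infty=\beta\beta\beta\cdots\in\mathfrak A^{\mathbb N}$. The shift is $\sigma((x_n)_{n\in\mathbb N})=(x_{n+1})_{n\in\mathbb N}$. A subshift over $\mathfrak A$ is a set $X\subseteq\mathfrak A^{\mathbb N}$ of the form $X=X_F$ for some $F\subseteq\mathfrak A^*$, where $X_F$ is the set of all sequences in which no word of $F$ occurs as a block. Every letter of $\mathfrak A$ is assumed to occur in some element of $X$. The language $\mathcal L_X$ is the set of all finite words (including $\omega$) occurring in some element of $X$. For $\alpha,\beta\in\mathcal L_X$ put $C(\alpha,\beta)=\{\beta x\in X:\alpha x\in X\}$. Let $\mathcal U$ be the Boolean algebra of subsets of $X$ generated by all $C(\alpha,\beta)$, $\alpha,\beta\in\mathcal L_X$ (closed under finite unions, finite intersections and complements in $X$). The unital subshift algebra $\widetilde{\mathcal A}_R(X)$ is the universal unital (associative)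 $R$-algebra with generators $\{p_A:A\in\mathcal U\}$ and $\{s_a,s_a^*:a\in\mathfrak A\}$ subject to: (i) $p_X=1$, $p_{A\cap B}=p_Ap_B$, $p_{A\cup B}=p_A+p_B-p_{A\cap B}$, $p_\emptyset=0$ for all $A,B\in\mathcal U$; (ii) $s_as_a^*s_a=s_a$ and $s_a^*s_as_a^*=s_a^*$ for all $a\in\mathfrak A$; (iii) $s_\beta s_\alpha^*s_\alpha s_\beta^*=p_{C(\alpha,\beta)}$ for all $\alpha,\beta\in\mathcal L_X$, where $s_\omega=s_\omega^*=1$, $s_\alpha=s_{\alpha_1}\cdots s_{\alpha_n}$ and $s_\alpha^*=s_{\alpha_n}^*\cdots s_{\alpha_1}^*$ for $\alpha=\alpha_1\cdots\alpha_n$. $\mathcal Q_X$ denotes the set of all one-point sets $\{p\}\in\mathcal U$ such that $p\neq\alpha\beta^\infty$ for all $\alpha,\beta\in\mathcal L_X$ with $\beta\ne\omega$; a one-point set in $\mathcal Q_X$ is identified with its element. For $x,y\in X$ write $x\sim y$ if there exist $m,n\in\mathbb N$ with $\sigma^m(x)=\sigma^n(y)$; $\mathcal Q_X/{\sim}$ is the set of equivalence classes in $\mathcal Q_X$. $\langle x\rangle$ is the two-sided ideal generated by $x$. The socle $\mathrm{Soc}(B)$ of an algebra $B$ is the sum of all minimal left ideals of $B$ (zero if there are none). *)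

theory Defs
  imports
    "HOL-Algebra.QuotRing"
    "HOL-Library.Poly_Mapping"
    "HOL-Library.Omega_Words_Fun"
begin

section \<open>Subshifts\<close>

text \<open>
  The alphabet is a type, so it is nonempty. Sequences and their concatenation and periodic
  iteration are those of \<^theory>\<open>HOL-Library.Omega_Words_Fun\<close>; the \<open>n\<close>-th power of the
  shift is \<^term>\<open>suffix n\<close>. A block of length zero occurs in every sequence.
\<close>

definition occurs_in :: "'a list \<Rightarrow> (nat \<Rightarrow> 'a) \<Rightarrow> bool" where
  "occurs_in w x \<longleftrightarrow> (\<exists>i j. w = x [i \<rightarrow> j])"

definition avoiding :: "'a list set \<Rightarrow> (nat \<Rightarrow> 'a) set" where
  "avoiding F = {x. \<forall>w\<in>F. \<not> occurs_in w x}"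

definition subshift :: "(nat \<Rightarrow> 'a) set \<Rightarrow> bool" where
  "subshift X \<longleftrightarrow> (\<exists>F. X = avoiding F)"

definition language :: "(nat \<Rightarrow> 'a) set \<Rightarrow> 'a list set" where
  "language X = {w. \<exists>x\<in>X. occurs_in w x}"

definition cyl :: "(nat \<Rightarrow> 'a) set \<Rightarrow> 'a list \<Rightarrow> 'a list \<Rightarrow> (nat \<Rightarrow> 'a) set" where
  "cyl X \<alpha> \<beta> = {\<beta> \<frown> x | x. \<beta> \<frown> x \<in> X \<and> \<alpha> \<frown> x \<in> X}"

inductive_set bool_alg :: "(nat \<Rightarrow> 'a) set \<Rightarrow> (nat \<Rightarrow> 'a) set set"
  for X :: "(nat \<Rightarrow> 'a) set" where
  gen: "\<alpha> \<in> language X \<Longrightarrow> \<beta> \<in> language X \<Longrightarrow> cyl X \<alpha> \<beta> \<in> bool_alg X"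
| Un: "A \<in> bool_alg X \<Longrightarrow> B \<in> bool_alg X \<Longrightarrow> A \<union> B \<in> bool_alg X"
| Int: "A \<in> bool_alg X \<Longrightarrow> B \<in> bool_alg X \<Longrightarrow> A \<inter> B \<in> bool_alg X"
| compl: "A \<in> bool_alg X \<Longrightarrow> X - A \<in> bool_alg X"

text \<open>One-point sets in the Boolean algebra are identified with their elements.\<close>

definition QX :: "(nat \<Rightarrow> 'a) set \<Rightarrow> (nat \<Rightarrow> 'a) set" where
  "QX X = {q. {q} \<in> bool_alg X \<and>
     (\<forall>\<alpha>\<in>language X. \<forall>\<beta>\<in>language X. \<beta> \<noteq> [] \<longrightarrow> q \<noteq> \<alpha> \<frown> \<beta>\<^sup>\<omega>)}"

definition tail_equiv :: "(nat \<Rightarrow> 'a) \<Rightarrow> (nat \<Rightarrow> 'a) \<Rightarrow> bool" where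
  "tail_equiv x y \<longleftrightarrow> (\<exists>m n. suffix m x = suffix n y)"

definition QX_classes :: "(nat \<Rightarrow> 'a) set \<Rightarrow> (nat \<Rightarrow> 'a) set set" where
  "QX_classes X = QX X // {(x, y). x \<in> QX X \<and> y \<in> QX X \<and> tail_equiv x y}"


section \<open>Free algebras\<close>

text \<open>
  The free monoid, written additively because \<^theory>\<open>HOL-Library.Poly_Mapping\<close> obtains the
  multiplication of a monoid algebra from addition of exponents.
\<close>

datatype 'g mon = Mon (letters: "'g list")

instantiation mon :: (type) monoid_add
begin

definition zero_mon :: "'a mon" where
  "zero_mon = Mon []"

definition plus_mon :: "'a mon \<Rightarrow> 'a mon \<Rightarrow> 'a mon" where
  "plus_mon u v = Mon (letters u @ letters v)"

instance
  by standard (simp_all add: zero_mon_def plus_mon_def)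

end

text \<open>
  The free unital algebra over \<^typ>\<open>'r\<close> on the set \<open>G\<close>: finite linear combinations of words
  in elements of \<open>G\<close>.
\<close>

definition free_algebra :: "'g set \<Rightarrow> ('g mon \<Rightarrow>\<^sub>0 'r::comm_ring_1) ring" where
  "free_algebra G =
     \<lparr>carrier = {f. \<forall>w\<in>Poly_Mapping.keys f. set (letters w) \<subseteq> G},
      mult = (*), one = 1, zero = 0, add = (+)\<rparr>"

definition var :: "'g \<Rightarrow> ('g mon \<Rightarrow>\<^sub>0 'r::comm_ring_1)" where
  "var g = Poly_Mapping.single (Mon [g]) 1"

lemma ring_free_algebra: "ring (free_algebra G :: ('g mon \<Rightarrow>\<^sub>0 'r::comm_ring_1) ring)"
proof -
  let ?F = "free_algebra G :: ('g mon \<Rightarrow>\<^sub>0 'r) ring"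
  have add: "f + g \<in> carrier ?F" if "f \<in> carrier ?F" "g \<in> carrier ?F" for f g
    using that Poly_Mapping.keys_add[of f g] unfolding free_algebra_def by auto
  have mult: "f * g \<in> carrier ?F" if "f \<in> carrier ?F" "g \<in> carrier ?F" for f g
    using that Poly_Mapping.keys_mult[of f g] unfolding free_algebra_def
    by (fastforce simp: plus_mon_def)
  have neg: "- f \<in> carrier ?F" if "f \<in> carrier ?F" for f
    using that by (simp add: free_algebra_def)
  have zero: "0 \<in> carrier ?F" and one: "1 \<in> carrier ?F"
    by (simp_all add: free_algebra_def zero_mon_def)
  have ops: "x \<oplus>\<^bsub>?F\<^esub> y = x + y" "x \<otimes>\<^bsub>?F\<^esub> y = x * y" "\<zero>\<^bsub>?F\<^esub> = 0" "\<one>\<^bsub>?F\<^esub> = 1" for x y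
    by (simp_all add: free_algebra_def)
  show ?thesis
  proof (rule ringI)
    show "abelian_group ?F"
      by (rule abelian_groupI) (auto simp: ops add zero ac_simps intro: bexI[OF _ neg])
    show "monoid ?F"
      by (rule monoidI) (auto simp: ops mult one mult.assoc)
  qed (simp_all add: ops algebra_simps)
qed


section \<open>The unital subshift algebra\<close>

datatype 'a sgen = P "(nat \<Rightarrow> 'a) set" | S 'a | Sstar 'a

definition sgens :: "(nat \<Rightarrow> 'a) set \<Rightarrow> 'a sgen set" where
  "sgens X = P ` bool_alg X \<union> range S \<union> range Sstar"

definition sword :: "'a list \<Rightarrow> ('a sgen mon \<Rightarrow>\<^sub>0 'r::comm_ring_1)" where
  "sword \<alpha> = prod_list (map (\<lambda>a. var (S a)) \<alpha>)"

definition sstarword :: "'a list \<Rightarrow> ('a sgen mon \<Rightarrow>\<^sub>0 'r::comm_ring_1)" where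
  "sstarword \<alpha> = prod_list (map (\<lambda>a. var (Sstar a)) (rev \<alpha>))"

text \<open>A relation \<open>u = v\<close> is encoded as the relator \<open>u - v\<close>.\<close>

definition relators :: "(nat \<Rightarrow> 'a) set \<Rightarrow> ('a sgen mon \<Rightarrow>\<^sub>0 'r::comm_ring_1) set" where
  "relators X =
     {var (P X) - 1, var (P {})}
   \<union> {var (P (A \<inter> B)) - var (P A) * var (P B) | A B. A \<in> bool_alg X \<and> B \<in> bool_alg X}
   \<union> {var (P (A \<union> B)) - (var (P A) + var (P B) - var (P (A \<inter> B))) | A B.
        A \<in> bool_alg X \<and> B \<in> bool_alg X}
   \<union> {var (S a) * var (Sstar a) * var (S a) - var (S a) | a. True}
   \<union> {var (Sstar a) * var (S a) * var (Sstar a) - var (Sstar a) | a. True}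
   \<union> {sword \<beta> * sstarword \<alpha> * sword \<alpha> * sstarword \<beta> - var (P (cyl X \<alpha> \<beta>)) | \<alpha> \<beta>.
        \<alpha> \<in> language X \<and> \<beta> \<in> language X}"

definition relation_ideal :: "(nat \<Rightarrow> 'a) set \<Rightarrow> ('a sgen mon \<Rightarrow>\<^sub>0 'r::comm_ring_1) set" where
  "relation_ideal X = Idl\<^bsub>free_algebra (sgens X)\<^esub> (relators X)"

text \<open>
  The scalars act through the images of the constants. As the algebra is unital, its left and
  two-sided ideals as a ring are automatically stable under scalars, so they are also its left
  and two-sided ideals as an algebra.
\<close>

definition subshift_algebra ::
    "'r::comm_ring_1 itself \<Rightarrow> (nat \<Rightarrow> 'a) set \<Rightarrow> ('a sgen mon \<Rightarrow>\<^sub>0 'r) set ring" where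
  "subshift_algebra R X = free_algebra (sgens X) Quot relation_ideal X"

definition proj ::
    "'r::comm_ring_1 itself \<Rightarrow> (nat \<Rightarrow> 'a) set \<Rightarrow> (nat \<Rightarrow> 'a) set \<Rightarrow> ('a sgen mon \<Rightarrow>\<^sub>0 'r) set" where
  "proj R X A = relation_ideal X +>\<^bsub>free_algebra (sgens X)\<^esub> var (P A)"

definition point_ideal ::
    "'r::comm_ring_1 itself \<Rightarrow> (nat \<Rightarrow> 'a) set \<Rightarrow> (nat \<Rightarrow> 'a) \<Rightarrow> ('a sgen mon \<Rightarrow>\<^sub>0 'r) set set" where
  "point_ideal R X q = Idl\<^bsub>subshift_algebra R X\<^esub> {proj R X {q}}"

definition class_ideal ::
    "'r::comm_ring_1 itself \<Rightarrow> (nat \<Rightarrow> 'a) set \<Rightarrow> (nat \<Rightarrow> 'a) set \<Rightarrow> ('a sgen mon \<Rightarrow>\<^sub>0 'r) set set" where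
  "class_ideal R X c = point_ideal R X (SOME q. q \<in> c)"


section \<open>Socle and internal direct sums\<close>

text \<open>Finite sums of elements taken from distinct members of the family; \<open>{\<zero>}\<close> if \<open>I\<close> is empty.\<close>

definition family_sum :: "('x, 'm) ring_scheme \<Rightarrow> 'i set \<Rightarrow> ('i \<Rightarrow> 'x set) \<Rightarrow> 'x set" where
  "family_sum B I J = {finsum B f F | f F. finite F \<and> F \<subseteq> I \<and> f \<in> Pi F J}"

definition left_ideal :: "'x set \<Rightarrow> ('x, 'm) ring_scheme \<Rightarrow> bool" where
  "left_ideal L B \<longleftrightarrow> additive_subgroup L B \<and> (\<forall>a\<in>L. \<forall>x\<in>carrier B. x \<otimes>\<^bsub>B\<^esub> a \<in> L)"

definition minimal_left_ideal :: "'x set \<Rightarrow> ('x, 'm) ring_scheme \<Rightarrow> bool" where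
  "minimal_left_ideal L B \<longleftrightarrow> left_ideal L B \<and> L \<noteq> {\<zero>\<^bsub>B\<^esub>} \<and>
     (\<forall>L'. left_ideal L' B \<and> L' \<subseteq> L \<longrightarrow> L' = {\<zero>\<^bsub>B\<^esub>} \<or> L' = L)"

definition socle :: "('x, 'm) ring_scheme \<Rightarrow> 'x set" where
  "socle B = family_sum B {L. minimal_left_ideal L B} (\<lambda>L. L)"

text \<open>The family is indexed, so two distinct indices can only share the zero ideal.\<close>

definition internal_direct_sum ::
    "('x, 'm) ring_scheme \<Rightarrow> 'i set \<Rightarrow> ('i \<Rightarrow> 'x set) \<Rightarrow> 'x set \<Rightarrow> bool" where
  "internal_direct_sum B I J T \<longleftrightarrow>
     (\<forall>i\<in>I. ideal (J i) B) \<and> T = family_sum B I J \<and>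
     (\<forall>f F. finite F \<and> F \<subseteq> I \<and> f \<in> Pi F J \<and> finsum B f F = \<zero>\<^bsub>B\<^esub> \<longrightarrow> (\<forall>i\<in>F. f i = \<zero>\<^bsub>B\<^esub>))"

end

theory Submission
  imports Defs
begin

text \<open>
  The algebra is represented faithfully by operators on functions of a point of \<open>X\<close> and an integer:
  \<open>s\<^sub>a\<close> and \<open>s\<^sub>a\<^sup>*\<close> prepend or delete a letter and move the integer by one. Monomials can be brought
  into the form \<open>s\<^sub>\<alpha> p\<^sub>A s\<^sub>\<beta>\<^sup>*\<close> with \<open>\<alpha>\<beta>\<^sup>-\<^sup>1\<close> reduced, and sums of those with distinct
  \<open>(\<alpha>, \<beta>)\<close> are detected by disjoint sets of germs; the integer keeps the germs at periodic points apart.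

  The socle is spanned by the \<open>x\<close> such that \<open>d x \<noteq> 0\<close> implies \<open>x \<in> B d x\<close>. For aperiodic isolated
  \<open>q\<close> the corner \<open>p\<^sub>q B p\<^sub>q\<close> consists of scalars, so \<open>p\<^sub>q\<close> is such an element. Conversely, given such
  an \<open>x \<noteq> 0\<close>, one moves it to some \<open>b = a x c\<close> with a nonzero diagonal entry. Away from finitely many
  points, \<open>b\<close> compresses to a scalar multiple of some \<open>p\<^sub>A\<close>, and simplicity makes \<open>A\<close> a singleton; in
  any case \<open>b\<close> has a nonzero diagonal entry at an isolated point \<open>z\<close>. If \<open>z\<close> were eventually periodic,
  compressing to \<open>z\<close> would give Laurent polynomials with \<open>1 - t\<^sup>n\<close> invertible. Hence
  \<open>x \<in> B p\<^sub>z a x\<close> with \<open>z\<close> aperiodic. Independence holds because \<open>\<langle>p\<^sub>q\<rangle>\<close> lives on the tail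
  class of \<open>q\<close>.
\<close>

section \<open>Socle of a ring\<close>

text \<open>The algebra is given by generators and relations, so no element is known to be nonzero
  until a representation separates it from zero. Plain functions on \<open>X\<close> do not suffice:
  over a one-letter alphabet \<open>X\<close> is a single point and \<open>s_a\<close> would act as
  the identity, although the algebra is that of Laurent polynomials in \<open>s_a\<close>. Recording
  the change of length repairs this, and since every operator then commutes with translations of the
  integer, compression to a point becomes multiplication by a Laurent polynomial.

  A second obstacle is that a minimal left ideal is not known to contain an idempotent. Minimality
  is therefore expressed through a single element \<open>x\<close> by a condition inherited by every
  \<open>a x c\<close>, so that one may cut on both sides with projections and words. The cutting
  succeeds because a nontrivial reduced pair of words fixes at most one point: a finite sum of
  monomials has finitely many such points, and around any other point a small cylinder meets none of
  its own translates under the nontrivial pairs.\<close>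

context ring
begin

lemma finsum_in_additive_subgroup:
  assumes H: "additive_subgroup H R" and "finite F" and "\<And>i. i \<in> F \<Longrightarrow> f i \<in> H"
  shows "finsum R f F \<in> H"
  using assms(2,3)
proof (induction F rule: finite_induct)
  case empty
  show ?case using additive_subgroup.zero_closed[OF H] by simp
next
  case (insert i F)
  have sub: "H \<subseteq> carrier R" using additive_subgroup.a_subset[OF H] .
  have "finsum R f (insert i F) = f i \<oplus> finsum R f F"
    using insert sub by (intro finsum_insert) auto
  then show ?case using insert additive_subgroup.a_closed[OF H] by auto
qed

lemma family_sum_least:
  assumes "additive_subgroup H R" and "\<And>i. i \<in> I \<Longrightarrow> J i \<subseteq> H"
  shows "family_sum R I J \<subseteq> H"
proof
  fix x assume "x \<in> family_sum R I J"
  then obtain f F where f: "x = finsum R f F" "finite F" "F \<subseteq> I" "f \<in> Pi F J"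
    unfolding family_sum_def by auto
  then have "f i \<in> H" if "i \<in> F" for i using assms(2) that by blast
  then show "x \<in> H" using finsum_in_additive_subgroup[OF assms(1) f(2)] f(1) by simp
qed

lemma family_sum_member:
  assumes "i \<in> I" and "x \<in> J i" and "J i \<subseteq> carrier R"
  shows "x \<in> family_sum R I J"
proof -
  have "x = finsum R (\<lambda>_. x) {i}" using assms by (auto simp: finsum_insert)
  then show ?thesis unfolding family_sum_def using assms
    by (intro CollectI exI[of _ "\<lambda>_. x"] exI[of _ "{i}"]) auto
qed

lemma additive_subgroup_family_sum:
  assumes J: "\<And>i. i \<in> I \<Longrightarrow> additive_subgroup (J i) R"
  shows "additive_subgroup (family_sum R I J) R"
proof (rule additive_subgroup.intro, rule add.subgroupI)
  have sub: "J i \<subseteq> carrier R" if "i \<in> I" for i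
    using additive_subgroup.a_subset[OF J[OF that]] .
  show "family_sum R I J \<subseteq> carrier R"
    by (rule family_sum_least) (use sub in \<open>auto intro!: additive_subgroup.intro add.subgroup_self\<close>)
  have "\<zero> \<in> family_sum R I J"
    unfolding family_sum_def by (intro CollectI exI[of _ "\<lambda>_. \<zero>"] exI[of _ "{}"]) auto
  then show "family_sum R I J \<noteq> {}" by auto
  fix x assume "x \<in> family_sum R I J"
  then obtain f F where f: "x = finsum R f F" "finite F" "F \<subseteq> I" "f \<in> Pi F J"
    unfolding family_sum_def by auto
  have fc: "f \<in> F \<rightarrow> carrier R" using f sub by blast
  have "finsum R f F \<oplus> finsum R (\<lambda>i. \<ominus> f i) F = finsum R (\<lambda>i. f i \<oplus> \<ominus> f i) F"
    using fc by (subst finsum_addf) auto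
  also have "\<dots> = finsum R (\<lambda>i. \<zero>) F"
    using fc by (intro finsum_cong') (auto simp: r_neg Pi_iff)
  finally have "finsum R f F \<oplus> finsum R (\<lambda>i. \<ominus> f i) F = \<zero>"
    by simp
  moreover have neg: "finsum R (\<lambda>i. \<ominus> f i) F \<in> carrier R"
    using fc by (intro finsum_closed) auto
  ultimately have "\<ominus> x = finsum R (\<lambda>i. \<ominus> f i) F"
    using f fc by (intro minus_equality) (auto simp: a_comm)
  moreover have "(\<lambda>i. \<ominus> f i) \<in> Pi F J"
  proof
    fix i assume "i \<in> F"
    then have "f i \<in> J i" "additive_subgroup (J i) R" using f J by auto
    then show "\<ominus> f i \<in> J i" 
      using subgroup.m_inv_closed[OF additive_subgroup.a_subgroup] by (simp add: a_inv_def)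
  qed
  ultimately show "\<ominus> x \<in> family_sum R I J"
    unfolding family_sum_def using f by blast
  fix y assume "y \<in> family_sum R I J"
  then obtain g G where g: "y = finsum R g G" "finite G" "G \<subseteq> I" "g \<in> Pi G J"
    unfolding family_sum_def by auto
  have gc: "g \<in> G \<rightarrow> carrier R" using g sub by blast
  \<comment> \<open>The two index sets may differ, so both families are extended by zero to the
    union; an index in both sets gets the sum of its two entries, which stays in the same
    member.\<close>
  let ?f = "\<lambda>i. if i \<in> F then f i else \<zero>" and ?g = "\<lambda>i. if i \<in> G then g i else \<zero>"
  have "finsum R f F = finsum R ?f (F \<union> G)"
    using f g fc by (intro add.finprod_mono_neutral_cong_left) auto
  moreover have "finsum R g G = finsum R ?g (F \<union> G)"
    using f g gc by (intro add.finprod_mono_neutral_cong_left) auto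
  ultimately have "x \<oplus> y = finsum R (\<lambda>i. ?f i \<oplus> ?g i) (F \<union> G)"
    using f(1) g(1) fc gc by (subst finsum_addf) (auto simp: Pi_iff)
  moreover have "(\<lambda>i. ?f i \<oplus> ?g i) \<in> Pi (F \<union> G) J"
  proof
    fix i assume i: "i \<in> F \<union> G"
    then have "additive_subgroup (J i) R" using f g J by auto
    then show "?f i \<oplus> ?g i \<in> J i"
      using f g i
      by (auto intro!: additive_subgroup.a_closed dest: additive_subgroup.zero_closed)
  qed
  ultimately show "x \<oplus> y \<in> family_sum R I J"
    unfolding family_sum_def using f g
    by (intro CollectI exI[of _ "\<lambda>i. ?f i \<oplus> ?g i"] exI[of _ "F \<union> G"]) auto
qed

text \<open>For nonzero \<open>x\<close> this is minimality of the left ideal of multiples of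
  \<open>x\<close>; zero satisfies it vacuously. The elementwise form is what two-sided
  multiplication preserves.\<close>

definition left_simple :: "'a \<Rightarrow> bool" where
  "left_simple x \<longleftrightarrow> x \<in> carrier R \<and>
     (\<forall>d\<in>carrier R. d \<otimes> x \<noteq> \<zero> \<longrightarrow> (\<exists>e\<in>carrier R. e \<otimes> (d \<otimes> x) = x))"

lemma left_ideal_multiples:
  assumes "x \<in> carrier R"
  shows "left_ideal {a \<otimes> x | a. a \<in> carrier R} R"
  unfolding left_ideal_def
proof (intro conjI ballI)
  show "additive_subgroup {a \<otimes> x |a. a \<in> carrier R} R"
  proof (rule additive_subgroup.intro, rule add.subgroupI)
    show "{a \<otimes> x |a. a \<in> carrier R} \<subseteq> carrier R" using assms by auto
    show "{a \<otimes> x |a. a \<in> carrier R} \<noteq> {}" by auto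
    fix y assume "y \<in> {a \<otimes> x |a. a \<in> carrier R}"
    then obtain a where a: "y = a \<otimes> x" "a \<in> carrier R" by auto
    have "\<ominus> y = (\<ominus> a) \<otimes> x" using a assms by (simp add: l_minus)
    then show "\<ominus> y \<in> {a \<otimes> x |a. a \<in> carrier R}" using a by auto
    fix z assume "z \<in> {a \<otimes> x |a. a \<in> carrier R}"
    then obtain b where b: "z = b \<otimes> x" "b \<in> carrier R" by auto
    have "y \<oplus> z = (a \<oplus> b) \<otimes> x" using a b assms by (simp add: l_distr)
    then show "y \<oplus> z \<in> {a \<otimes> x |a. a \<in> carrier R}" using a b by auto
  qed
next
  fix y z assume "y \<in> {a \<otimes> x |a. a \<in> carrier R}" and z: "z \<in> carrier R"
  then obtain a where "y = a \<otimes> x" "a \<in> carrier R" by auto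
  then have "z \<otimes> y = (z \<otimes> a) \<otimes> x" using z assms by (simp add: m_assoc)
  then show "z \<otimes> y \<in> {a \<otimes> x |a. a \<in> carrier R}" using \<open>a \<in> carrier R\<close> z by auto
qed

text \<open>The multiples of a nonzero \<open>d \<otimes> x\<close> form a nonzero left ideal inside
  \<open>L\<close>, hence all of \<open>L\<close>, and so reach \<open>x\<close> again.\<close>

lemma left_simple_if_in_minimal_left_ideal:
  assumes L: "minimal_left_ideal L R" and "x \<in> L"
  shows "left_simple x"
  unfolding left_simple_def
proof (intro conjI ballI impI)
  have sub: "additive_subgroup L R" and cl: "\<And>a y. a \<in> L \<Longrightarrow> y \<in> carrier R \<Longrightarrow> y \<otimes> a \<in> L"
    and min: "\<And>L'. left_ideal L' R \<Longrightarrow> L' \<subseteq> L \<Longrightarrow> L' = {\<zero>} \<or> L' = L"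
    using L unfolding minimal_left_ideal_def left_ideal_def by auto
  show x: "x \<in> carrier R" using additive_subgroup.a_subset[OF sub] assms(2) by auto
  fix d assume d: "d \<in> carrier R" "d \<otimes> x \<noteq> \<zero>"
  let ?L = "{a \<otimes> (d \<otimes> x) | a. a \<in> carrier R}"
  have "?L \<subseteq> L" using cl[OF cl[OF assms(2) d(1)]] by auto
  moreover have "left_ideal ?L R" using left_ideal_multiples d x by simp
  moreover have "\<one> \<otimes> (d \<otimes> x) \<in> ?L" by blast
  then have "?L \<noteq> {\<zero>}" using d x by auto
  ultimately have "?L = L" using min by blast
  then show "\<exists>e\<in>carrier R. e \<otimes> (d \<otimes> x) = x" using assms(2) by force
qed

text \<open>If \<open>d\<close> does not kill \<open>a x c\<close>, then \<open>d a\<close> does not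
  kill \<open>x\<close>; whatever recovers \<open>x\<close> from \<open>d a x\<close> recovers
  \<open>a x c\<close> after a further multiplication by \<open>a\<close>.\<close>

lemma left_simple_mult:
  assumes x: "left_simple x" and a: "a \<in> carrier R" and c: "c \<in> carrier R"
  shows "left_simple (a \<otimes> x \<otimes> c)"
  unfolding left_simple_def
proof (intro conjI ballI impI)
  have xc: "x \<in> carrier R" using x unfolding left_simple_def by auto
  show "a \<otimes> x \<otimes> c \<in> carrier R" using xc a c by auto
  fix d assume d: "d \<in> carrier R" "d \<otimes> (a \<otimes> x \<otimes> c) \<noteq> \<zero>"
  have "d \<otimes> (a \<otimes> x \<otimes> c) = ((d \<otimes> a) \<otimes> x) \<otimes> c" using d a c xc by (simp add: m_assoc)
  then have "(d \<otimes> a) \<otimes> x \<noteq> \<zero>" using d c by auto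
  then obtain e where e: "e \<in> carrier R" "e \<otimes> ((d \<otimes> a) \<otimes> x) = x"
    using x d a unfolding left_simple_def by blast
  have "(a \<otimes> e) \<otimes> (d \<otimes> (a \<otimes> x \<otimes> c)) = a \<otimes> (e \<otimes> ((d \<otimes> a) \<otimes> x)) \<otimes> c"
    using d(1) a c xc e(1) by (simp only: m_assoc m_closed)
  also have "\<dots> = a \<otimes> x \<otimes> c" using e by simp
  finally show "\<exists>e\<in>carrier R. e \<otimes> (d \<otimes> (a \<otimes> x \<otimes> c)) = a \<otimes> x \<otimes> c"
    using a e by blast
qed

lemma minimal_left_ideal_multiples:
  assumes x: "left_simple x" and "x \<noteq> \<zero>"
  shows "minimal_left_ideal {a \<otimes> x | a. a \<in> carrier R} R" (is "minimal_left_ideal ?L R")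
  unfolding minimal_left_ideal_def
proof (intro conjI allI impI)
  have xc: "x \<in> carrier R" using x unfolding left_simple_def by auto
  show "left_ideal ?L R" using left_ideal_multiples xc .
  have "\<one> \<otimes> x \<in> ?L" by blast
  then show "?L \<noteq> {\<zero>}" using xc assms(2) by auto
  fix L' assume L': "left_ideal L' R \<and> L' \<subseteq> ?L"
  show "L' = {\<zero>} \<or> L' = ?L"
  proof (cases "L' \<subseteq> {\<zero>}")
    case True
    then show ?thesis
      using L' additive_subgroup.zero_closed unfolding left_ideal_def by fastforce
  next
    case False
    then obtain d where d: "d \<in> carrier R" "d \<otimes> x \<in> L'" "d \<otimes> x \<noteq> \<zero>" using L' by auto
    then obtain e where "e \<in> carrier R" "e \<otimes> (d \<otimes> x) = x" using x unfolding left_simple_def by auto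
    then have "x \<in> L'" using L' d unfolding left_ideal_def by metis
    then show ?thesis using L' unfolding left_ideal_def by auto
  qed
qed

lemma left_simple_in_socle:
  assumes "left_simple x"
  shows "x \<in> socle R"
proof (cases "x = \<zero>")
  case True
  have "additive_subgroup (socle R) R"
    unfolding socle_def
    by (rule additive_subgroup_family_sum) (auto simp: minimal_left_ideal_def left_ideal_def)
  then show ?thesis using True additive_subgroup.zero_closed by auto
next
  case False
  have xc: "x \<in> carrier R" using assms unfolding left_simple_def by auto
  let ?L = "{a \<otimes> x | a. a \<in> carrier R}"
  have "x = \<one> \<otimes> x" using xc by simp
  then have "x \<in> ?L" by blast
  moreover have "?L \<subseteq> carrier R" using xc by auto
  ultimately show ?thesis
    unfolding socle_def using family_sum_member[of ?L _ x "\<lambda>L. L"]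
      minimal_left_ideal_multiples[OF assms False] by simp
qed

text \<open>Right multiplication need not map a minimal left ideal into itself, but it keeps each
  summand left simple and therefore inside the socle.\<close>

lemma ideal_socle: "ideal (socle R) R"
proof (rule idealI)
  have sg: "additive_subgroup (socle R) R"
    unfolding socle_def
    by (rule additive_subgroup_family_sum) (auto simp: minimal_left_ideal_def left_ideal_def)
  then show "subgroup (socle R) (add_monoid R)" by (rule additive_subgroup.a_subgroup)
  show "ring R" by (rule ring_axioms)
  fix a x assume a: "a \<in> socle R" and x: "x \<in> carrier R"
  obtain f F where f: "a = finsum R f F" "finite F" "F \<subseteq> {L. minimal_left_ideal L R}"
    "f \<in> Pi F (\<lambda>L. L)"
    using a unfolding socle_def family_sum_def by auto
  have ls: "left_simple (f i)" if "i \<in> F" for i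
    using f that left_simple_if_in_minimal_left_ideal[of i "f i"] by auto
  then have fc: "f \<in> F \<rightarrow> carrier R" unfolding left_simple_def by auto
  have "left_simple (\<one> \<otimes> f i \<otimes> x)" "left_simple (x \<otimes> f i \<otimes> \<one>)" if "i \<in> F" for i
    using left_simple_mult[OF ls[OF that]] x by auto
  then have "f i \<otimes> x \<in> socle R" "x \<otimes> f i \<in> socle R" if "i \<in> F" for i
    using left_simple_in_socle that fc x by (force simp: Pi_iff)+
  moreover have "x \<otimes> a = finsum R (\<lambda>i. x \<otimes> f i) F" "a \<otimes> x = finsum R (\<lambda>i. f i \<otimes> x) F"
    using f x fc by (auto simp: finsum_rdistr finsum_ldistr)
  ultimately show "x \<otimes> a \<in> socle R" "a \<otimes> x \<in> socle R"
    using finsum_in_additive_subgroup[OF sg f(2)] by auto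
qed

lemma socle_least:
  assumes "additive_subgroup H R" and "\<And>x. left_simple x \<Longrightarrow> x \<in> H"
  shows "socle R \<subseteq> H"
  unfolding socle_def using assms(2) left_simple_if_in_minimal_left_ideal
  by (intro family_sum_least[OF assms(1)]) auto

end


section \<open>Words and the Boolean algebra of a subshift\<close>

lemma conc_overlap:
  assumes "\<alpha> \<frown> u = \<beta> \<frown> v" and "length \<alpha> \<le> length \<beta>"
  obtains \<gamma> where "\<beta> = \<alpha> @ \<gamma>" and "u = \<gamma> \<frown> v"
proof
  have "take (length \<alpha>) \<beta> = \<alpha>"
    using assms by (metis prefix_conc_fst prefix_conc_length)
  then show b: "\<beta> = \<alpha> @ drop (length \<alpha>) \<beta>" by (metis append_take_drop_id)
  have "\<alpha> \<frown> u = \<alpha> \<frown> drop (length \<alpha>) \<beta> \<frown> v"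
    using b assms(1) by (metis conc_conc)
  then show "u = drop (length \<alpha>) \<beta> \<frown> v" by (simp only: same_concat_eq)
qed

text \<open>A position beyond the first copy of \<open>\<gamma>\<close> is lowered by
  \<open>length \<gamma>\<close>, which changes neither side: not \<open>w\<close> by the fixpoint
  equation, not \<open>iter\<close> by periodicity.\<close>

lemma conc_fixpoint_eq_iter:
  assumes w: "w = \<gamma> \<frown> w" and g: "\<gamma> \<noteq> []"
  shows "w = \<gamma>\<^sup>\<omega>"
proof
  fix n
  show "w n = (\<gamma>\<^sup>\<omega>) n"
  proof (induction n rule: less_induct)
    case (less n)
    show ?case
    proof (cases "n < length \<gamma>")
      case True
      then have "w n = \<gamma> ! n" using w by (metis conc_fst)
      then show ?thesis using True g by simp
    next
      case False
      then have "w n = w (n - length \<gamma>)" using w by (metis conc_snd)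
      also have "\<dots> = (\<gamma>\<^sup>\<omega>) (n - length \<gamma>)" using False g by (intro less) (cases \<gamma>, auto)
      also have "\<dots> = (\<gamma>\<^sup>\<omega>) n" using False g by (simp add: le_mod_geq)
      finally show ?thesis .
    qed
  qed
qed

text \<open>In \<open>s_\<alpha> p_A s_\<beta>^*\<close> the letters next to \<open>p_A\<close> are
  the last ones of \<open>\<alpha>\<close> and \<open>\<beta>\<close>. If they agree,
  \<open>s_p_t\<close> contracts them into the projection; reduced pairs are those where this is
  impossible.\<close>

definition reduced :: "'a list \<Rightarrow> 'a list \<Rightarrow> bool" where
  "reduced \<alpha> \<beta> \<longleftrightarrow> \<alpha> = [] \<or> \<beta> = [] \<or> last \<alpha> \<noteq> last \<beta>"

text \<open>The germ of \<open>s\<^sub>\<alpha> s\<^sub>\<beta>\<^sup>*\<close> at a point determines the reduced pair, although only the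
  length difference is recorded.\<close>

lemma reduced_unique:
  assumes "reduced \<alpha> \<beta>" and "reduced \<alpha>' \<beta>'"
    and x: "\<alpha> \<frown> w = \<alpha>' \<frown> w'" and y: "\<beta> \<frown> w = \<beta>' \<frown> w'"
    and l: "int (length \<alpha>) - int (length \<beta>) = int (length \<alpha>') - int (length \<beta>')"
  shows "\<alpha> = \<alpha>' \<and> \<beta> = \<beta>' \<and> w = w'"
proof -
  have *: "\<alpha> = \<alpha>' \<and> \<beta> = \<beta>' \<and> w = w'"
    if red: "reduced \<alpha>' \<beta>'" and x: "\<alpha> \<frown> w = \<alpha>' \<frown> w'" and y: "\<beta> \<frown> w = \<beta>' \<frown> w'"
      and l: "int (length \<alpha>) - int (length \<beta>) = int (length \<alpha>') - int (length \<beta>')"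
      and le: "length \<alpha> \<le> length \<alpha>'" for \<alpha> \<beta> w \<alpha>' \<beta>' w'
  proof -
    obtain \<gamma> where g: "\<alpha>' = \<alpha> @ \<gamma>" "w = \<gamma> \<frown> w'" using conc_overlap[OF x le] .
    obtain \<gamma>' where g': "\<beta>' = \<beta> @ \<gamma>'" "w = \<gamma>' \<frown> w'"
      using conc_overlap[OF y] l le by auto
    \<comment> \<open>The recorded difference makes both overhangs equally long, so they are the
      same prefix of \<open>w\<close>; a nonempty one would be a common ending of the reduced
      pair.\<close>
    have "length \<gamma> = length \<gamma>'" using l g g' by simp
    then have "\<gamma> = \<gamma>'" using g(2) g'(2) by simp
    then have "\<gamma> = []" using red g(1) g'(1) unfolding reduced_def by (cases "\<gamma> = []") auto
    then show ?thesis using g g' \<open>\<gamma> = \<gamma>'\<close> by simp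
  qed
  show ?thesis
  proof (cases "length \<alpha> \<le> length \<alpha>'")
    case True
    then show ?thesis using * assms by blast
  next
    case False
    then show ?thesis using *[OF assms(1) x[symmetric] y[symmetric] l[symmetric]] by auto
  qed
qed

text \<open>\<open>pull\<close> and \<open>push\<close> describe what becomes of a projection when
  it is carried past a letter (\<open>p_s\<close>, \<open>t_p\<close>) or enclosed between
  \<open>s a\<close> and its star (\<open>s_p_t\<close>).\<close>

definition pull :: "(nat \<Rightarrow> 'a) set \<Rightarrow> 'a list \<Rightarrow> (nat \<Rightarrow> 'a) set" where
  "pull A \<alpha> = {w. \<alpha> \<frown> w \<in> A}"

definition push :: "'a \<Rightarrow> (nat \<Rightarrow> 'a) set \<Rightarrow> (nat \<Rightarrow> 'a) set \<Rightarrow> (nat \<Rightarrow> 'a) set" where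
  "push a X A = {a ## w | w. w \<in> A \<and> a ## w \<in> X}"

lemma pull_Nil [simp]: "pull A [] = A"
  by (simp add: pull_def)

lemma pull_append: "pull A (\<alpha> @ \<beta>) = pull (pull A \<alpha>) \<beta>"
  by (simp add: pull_def del: conc_conc add: conc_conc[symmetric])

lemma pull_Cons: "pull A (a # \<alpha>) = pull (pull A [a]) \<alpha>"
  using pull_append[of A "[a]" \<alpha>] by simp

section \<open>Closure properties of the Boolean algebra\<close>

locale letter_subshift =
  fixes X :: "(nat \<Rightarrow> 'a) set"
  assumes subshift: "subshift X" and letters_occur: "\<forall>a. \<exists>x\<in>X. a \<in> range x"
begin

lemma suffix_closed: "x \<in> X \<Longrightarrow> suffix k x \<in> X"
proof -
  assume x: "x \<in> X"
  obtain F where F: "X = avoiding F" using subshift unfolding subshift_def by auto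
  have "occurs_in w x" if "occurs_in w (suffix k x)" for w
    using that unfolding occurs_in_def by auto
  then show ?thesis using x unfolding F avoiding_def by auto
qed

lemma conc_tail: "\<alpha> \<frown> w \<in> X \<Longrightarrow> w \<in> X"
  using suffix_closed[of "\<alpha> \<frown> w" "length \<alpha>"] by simp

lemma build_tail: "a ## w \<in> X \<Longrightarrow> w \<in> X"
  using conc_tail[of "[a]" w] by simp

lemma prefix_in_language: "\<alpha> \<frown> w \<in> X \<Longrightarrow> \<alpha> \<in> language X"
  unfolding language_def occurs_in_def
  by (intro CollectI bexI[of _ "\<alpha> \<frown> w"] exI[of _ 0] exI[of _ "length \<alpha>"]) auto

lemma subsequence_in_language: "x \<in> X \<Longrightarrow> subsequence x i j \<in> language X"
  unfolding language_def occurs_in_def by auto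

lemma nonempty: "X \<noteq> {}"
  using letters_occur by auto

lemma Nil_in_language [simp]: "[] \<in> language X"
  using nonempty prefix_in_language[of "[]"] by auto

lemma language_Cons: "a # \<alpha> \<in> language X \<Longrightarrow> \<alpha> \<in> language X"
proof -
  assume "a # \<alpha> \<in> language X"
  then obtain x i j where "x \<in> X" "a # \<alpha> = subsequence x i j" unfolding language_def occurs_in_def by auto
  then have "\<alpha> = drop 1 (subsequence x i j)" by (metis drop0 drop_Suc_Cons One_nat_def)
  then have "\<alpha> = subsequence x (i + 1) j" by simp
  then show ?thesis using subsequence_in_language \<open>x \<in> X\<close> by blast
qed

lemma letter_in_language [simp]: "[a] \<in> language X"
proof -
  obtain x i where "x \<in> X" "a = x i" using letters_occur by blast
  then show ?thesis using subsequence_in_language[of x i "Suc i"] by simp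
qed

lemma bool_alg_subset: "A \<in> bool_alg X \<Longrightarrow> A \<subseteq> X"
  by (induction rule: bool_alg.induct) (auto simp: cyl_def)

lemma X_in_bool_alg [simp]: "X \<in> bool_alg X"
  using bool_alg.gen[of "[]" X "[]"] by (auto simp: cyl_def)

lemma empty_in_bool_alg [simp]: "{} \<in> bool_alg X"
  using bool_alg.compl[OF X_in_bool_alg] by simp

lemma diff_in_bool_alg [simp]:
  assumes "A \<in> bool_alg X" and "B \<in> bool_alg X" shows "A - B \<in> bool_alg X"
proof -
  have "A - B = A \<inter> (X - B)" using bool_alg_subset assms by auto
  then show ?thesis using bool_alg.Int[OF assms(1) bool_alg.compl[OF assms(2)]] by simp
qed

lemmas bool_alg_ops [simp] = bool_alg.Un bool_alg.Int

text \<open>A point of a nonempty cylinder set exhibits both words as prefixes of elements of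
  \<open>X\<close>, hence as members of the language; the empty set belongs to the algebra as a
  complement.\<close>

lemma cyl_in_bool_alg [simp]: "cyl X \<alpha> \<beta> \<in> bool_alg X"
proof (cases "cyl X \<alpha> \<beta> = {}")
  case False
  then show ?thesis
    by (intro bool_alg.gen) (auto simp: cyl_def intro: prefix_in_language)
qed simp

lemma prefix_cyl: "cyl X [] \<beta> = {x \<in> X. prefix (length \<beta>) x = \<beta>}"
proof (intro equalityI subsetI)
  fix x assume "x \<in> {x \<in> X. prefix (length \<beta>) x = \<beta>}"
  then have x: "x \<in> X" "prefix (length \<beta>) x = \<beta>" by auto
  have "x = \<beta> \<frown> suffix (length \<beta>) x" using prefix_suffix[of x "length \<beta>"] unfolding x(2) .
  moreover have "suffix (length \<beta>) x \<in> X" using x suffix_closed by blast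
  ultimately show "x \<in> cyl X [] \<beta>" unfolding cyl_def conc_empty using x(1) by (metis (mono_tags, lifting) mem_Collect_eq)
qed (auto simp: cyl_def)

lemma pull_cyl:
  "pull (cyl X \<alpha> \<beta>) [a] = (if \<beta> = [] then cyl X [a] [] \<inter> cyl X (\<alpha> @ [a]) []
     else if hd \<beta> = a then cyl X [a] [] \<inter> cyl X \<alpha> (tl \<beta>) else {})"
  by (cases \<beta>) (auto simp: pull_def cyl_def dest: build_tail)

lemma pull_letter_in_bool_alg:
  assumes "A \<in> bool_alg X" shows "pull A [a] \<in> bool_alg X"
  using assms
proof (induction rule: bool_alg.induct)
  case (gen \<alpha> \<beta>)
  show ?case by (simp add: pull_cyl)
next
  case (Un A B)
  have "pull (A \<union> B) [a] = pull A [a] \<union> pull B [a]" by (auto simp: pull_def)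
  then show ?case using Un by simp
next
  case (Int A B)
  have "pull (A \<inter> B) [a] = pull A [a] \<inter> pull B [a]" by (auto simp: pull_def)
  then show ?case using Int by simp
next
  case (compl A)
  \<comment> \<open>Complements are relative to \<open>X\<close>, so they pull back to complements
    relative to the domain of the letter \<open>a\<close>.\<close>
  have "pull (X - A) [a] = cyl X [a] [] - pull A [a]" by (auto simp: pull_def cyl_def dest: build_tail)
  then show ?case using compl by simp
qed

lemma pull_in_bool_alg [simp]: "A \<in> bool_alg X \<Longrightarrow> pull A \<alpha> \<in> bool_alg X"
proof (induction \<alpha> arbitrary: A)
  case (Cons a \<alpha>)
  then show ?case using pull_letter_in_bool_alg by (subst pull_Cons) auto
qed simp

lemma push_in_bool_alg [simp]:
  assumes "A \<in> bool_alg X" shows "push a X A \<in> bool_alg X"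
  using assms
proof (induction rule: bool_alg.induct)
  case (gen \<alpha> \<beta>)
  have "push a X (cyl X \<alpha> \<beta>) = cyl X \<alpha> (a # \<beta>)" by (auto simp: push_def cyl_def dest: build_tail)
  then show ?case by simp
next
  case (Un A B)
  have "push a X (A \<union> B) = push a X A \<union> push a X B" by (auto simp: push_def)
  then show ?case using Un by simp
next
  case (Int A B)
  have "push a X (A \<inter> B) = push a X A \<inter> push a X B" by (auto simp: push_def)
  then show ?case using Int by simp
next
  case (compl A)
  have "push a X (X - A) = cyl X [] [a] - push a X A"
    by (auto simp: push_def cyl_def dest: build_tail)
  then show ?case using compl by simp
qed

end


section \<open>The representation and the defining relations\<close>

lemma poly_mapping_eq_sum_single:
  fixes f :: "'b \<Rightarrow>\<^sub>0 'c::comm_monoid_add"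
  shows "f = (\<Sum>k\<in>Poly_Mapping.keys f. Poly_Mapping.single k (Poly_Mapping.lookup f k))"
proof (rule poly_mapping_eqI)
  fix k
  show "Poly_Mapping.lookup f k = Poly_Mapping.lookup
      (\<Sum>k\<in>Poly_Mapping.keys f. Poly_Mapping.single k (Poly_Mapping.lookup f k)) k"
    by (cases "k \<in> Poly_Mapping.keys f")
      (auto simp: lookup_sum lookup_single when_def in_keys_iff)
qed

lemma poly_mapping_additive_induct [case_names zero single add]:
  fixes f :: "'b \<Rightarrow>\<^sub>0 'c::comm_monoid_add"
  assumes "Q 0" and "\<And>k c. Q (Poly_Mapping.single k c)" and "\<And>f g. Q f \<Longrightarrow> Q g \<Longrightarrow> Q (f + g)"
  shows "Q f"
proof -
  have "Q (\<Sum>k\<in>K. Poly_Mapping.single k (Poly_Mapping.lookup f k))" if "finite K" for K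
    using that by (induction K rule: finite_induct) (auto intro: assms)
  then show ?thesis by (subst poly_mapping_eq_sum_single) simp
qed

lemma single_zero_central:
  fixes f :: "'b::monoid_add \<Rightarrow>\<^sub>0 'r::comm_ring_1"
  shows "Poly_Mapping.single 0 c * f = f * Poly_Mapping.single 0 c"
  by (induction f rule: poly_mapping_additive_induct)
    (simp_all add: algebra_simps mult_single)

lemma prefix_Suc_eq_Cons_iff: "prefix (Suc n) x = a # \<alpha> \<longleftrightarrow> x 0 = a \<and> prefix n (suffix 1 x) = \<alpha>"
  unfolding subsequence_def map_upt_Suc by (auto simp: suffix_def)

lemma prefix_length_eq_iff: "prefix (length \<alpha>) x = \<alpha> \<longleftrightarrow> (\<exists>w. x = \<alpha> \<frown> w)"
  by (metis prefix_suffix prefix_conc_length)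

lemma suffix_build [simp]: "suffix (Suc 0) (a ## x) = x"
  by (simp add: fun_eq_iff)

section \<open>The graded action of the free algebra\<close>

type_synonym ('a, 'r) graded_fun = "(nat \<Rightarrow> 'a) \<Rightarrow> int \<Rightarrow> 'r"

primrec gact :: "(nat \<Rightarrow> 'a) set \<Rightarrow> 'a sgen \<Rightarrow> ('a, 'r::comm_ring_1) graded_fun \<Rightarrow> ('a, 'r) graded_fun"
where
  "gact X (P A) \<phi> = (\<lambda>x k. if x \<in> X \<and> x \<in> A then \<phi> x k else 0)"
| "gact X (S a) \<phi> = (\<lambda>x k. if x \<in> X \<and> x 0 = a then \<phi> (suffix 1 x) (k - 1) else 0)"
| "gact X (Sstar a) \<phi> = (\<lambda>x k. if x \<in> X \<and> a ## x \<in> X then \<phi> (a ## x) (k + 1) else 0)"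

text \<open>The action lives on functions vanishing outside \<open>X\<close>, so the empty word acts as the
  restriction to \<open>X\<close>.\<close>

primrec wact :: "(nat \<Rightarrow> 'a) set \<Rightarrow> 'a sgen list \<Rightarrow> ('a, 'r::comm_ring_1) graded_fun \<Rightarrow> ('a, 'r) graded_fun"
where
  "wact X [] \<phi> = (\<lambda>x k. if x \<in> X then \<phi> x k else 0)"
| "wact X (g # w) \<phi> = gact X g (wact X w \<phi>)"

definition act :: "(nat \<Rightarrow> 'a) set \<Rightarrow> ('a sgen mon \<Rightarrow>\<^sub>0 'r) \<Rightarrow> ('a, 'r::comm_ring_1) graded_fun \<Rightarrow> ('a, 'r) graded_fun"
where
  "act X f \<phi> = (\<lambda>x k. \<Sum>w\<in>Poly_Mapping.keys f. Poly_Mapping.lookup f w * wact X (letters w) \<phi> x k)"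

lemma gact_outside: "x \<notin> X \<Longrightarrow> gact X g \<phi> x k = 0"
  by (cases g) auto

lemma gact_add: "gact X g (\<lambda>x k. \<phi> x k + \<psi> x k) = (\<lambda>x k. gact X g \<phi> x k + gact X g \<psi> x k)"
  by (cases g) (auto simp: fun_eq_iff)

lemma gact_scale: "gact X g (\<lambda>x k. c * \<phi> x k) = (\<lambda>x k. c * gact X g \<phi> x k)"
  by (cases g) (auto simp: fun_eq_iff)

lemma wact_add: "wact X w (\<lambda>x k. \<phi> x k + \<psi> x k) = (\<lambda>x k. wact X w \<phi> x k + wact X w \<psi> x k)"
  by (induction w) (simp add: fun_eq_iff, simp add: gact_add)

lemma wact_scale: "wact X w (\<lambda>x k. c * \<phi> x k) = (\<lambda>x k. c * wact X w \<phi> x k)"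
  by (induction w) (simp add: fun_eq_iff, simp add: gact_scale)

lemma wact_zero: "wact X w (\<lambda>x k. 0) = (\<lambda>x k. 0)"
  using wact_scale[of X w 0] by simp

lemma wact_outside: "x \<notin> X \<Longrightarrow> wact X w \<phi> x k = 0"
  by (cases w) (auto simp: gact_outside)

lemma wact_append: "wact X (u @ v) \<phi> = wact X u (wact X v \<phi>)"
  by (induction u) (simp add: fun_eq_iff wact_outside, simp)

lemma act_superset:
  assumes "finite W" and "Poly_Mapping.keys f \<subseteq> W"
  shows "act X f \<phi> x k = (\<Sum>w\<in>W. Poly_Mapping.lookup f w * wact X (letters w) \<phi> x k)"
  unfolding act_def using assms by (intro sum.mono_neutral_left) (auto simp: in_keys_iff)

lemma act_add: "act X (f + g) \<phi> = (\<lambda>x k. act X f \<phi> x k + act X g \<phi> x k)"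
proof (intro ext)
  fix x k
  let ?W = "Poly_Mapping.keys f \<union> Poly_Mapping.keys g"
  have "act X h \<phi> x k = (\<Sum>w\<in>?W. Poly_Mapping.lookup h w * wact X (letters w) \<phi> x k)"
    if "Poly_Mapping.keys h \<subseteq> ?W" for h :: "'a sgen mon \<Rightarrow>\<^sub>0 'b"
    using that by (intro act_superset) auto
  then show "act X (f + g) \<phi> x k = act X f \<phi> x k + act X g \<phi> x k"
    using Poly_Mapping.keys_add[of f g]
    by (simp add: lookup_add sum.distrib[symmetric] distrib_right)
qed

lemma act_single: "act X (Poly_Mapping.single w c) \<phi> = (\<lambda>x k. c * wact X (letters w) \<phi> x k)"
  by (cases "c = 0") (auto simp: act_def fun_eq_iff)

lemma act_0 [simp]: "act X 0 \<phi> = (\<lambda>x k. 0)"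
  by (simp add: act_def)

lemma act_uminus: "act X (- f) \<phi> = (\<lambda>x k. - act X f \<phi> x k)"
proof (intro ext)
  fix x k
  have "act X (f + - f) \<phi> x k = act X f \<phi> x k + act X (- f) \<phi> x k" by (simp only: act_add)
  then show "act X (- f) \<phi> x k = - act X f \<phi> x k" by (simp add: eq_neg_iff_add_eq_0 add.commute)
qed

lemma act_diff: "act X (f - g) \<phi> = (\<lambda>x k. act X f \<phi> x k - act X g \<phi> x k)"
  using act_add[of X f "- g" \<phi>] by (simp add: act_uminus)

lemma act_arg_add:
  "act X f (\<lambda>x k. \<phi> x k + \<psi> x k) = (\<lambda>x k. act X f \<phi> x k + act X f \<psi> x k)"
  by (simp add: act_def wact_add distrib_left sum.distrib)

lemma act_arg_zero: "act X f (\<lambda>x k. 0) = (\<lambda>x k. 0)"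
  by (simp add: act_def wact_zero)

lemma act_mult: "act X (f * g) \<phi> = act X f (act X g \<phi>)"
proof (induction f rule: poly_mapping_additive_induct)
  case zero
  show ?case by simp
next
  case (single u c)
  show ?case
  proof (induction g rule: poly_mapping_additive_induct)
    case zero
    show ?case by (simp add: act_single wact_zero)
  next
    case (single v d)
    show ?case
      by (simp add: mult_single act_single wact_scale plus_mon_def wact_append mult.assoc)
  next
    case (add f g)
    then show ?case by (simp add: distrib_left act_add act_arg_add)
  qed
next
  case (add f g)
  then show ?case by (simp add: distrib_right act_add)
qed

lemma act_outside: "x \<notin> X \<Longrightarrow> act X f \<phi> x k = 0"
  by (simp add: act_def wact_outside)

lemma act_var: "act X (var g) \<phi> = gact X g (\<lambda>x k. if x \<in> X then \<phi> x k else 0)"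
  by (simp add: var_def act_single)

lemma act_one: "act X 1 \<phi> = (\<lambda>x k. if x \<in> X then \<phi> x k else 0)"
  by (simp flip: single_one add: act_single zero_mon_def)

lemma sword_Cons: "sword (a # \<alpha>) = var (S a) * sword \<alpha>"
  by (simp add: sword_def)

lemma sword_append: "sword (\<alpha> @ \<beta>) = sword \<alpha> * sword \<beta>"
  by (simp add: sword_def)

lemma sstarword_append: "sstarword (\<alpha> @ \<beta>) = sstarword \<beta> * sstarword \<alpha>"
  by (simp add: sstarword_def)

lemma sword_Nil [simp]: "sword [] = 1" and sstarword_Nil [simp]: "sstarword [] = 1"
  and sword_letter: "sword [a] = var (S a)" and sstarword_letter: "sstarword [a] = var (Sstar a)"
  by (simp_all add: sword_def sstarword_def)

lemma sstarword_Cons: "sstarword (a # \<alpha>) = sstarword \<alpha> * var (Sstar a)"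
  by (simp add: sstarword_def)

definition smonom :: "'a list \<Rightarrow> (nat \<Rightarrow> 'a) set \<Rightarrow> 'a list \<Rightarrow> ('a sgen mon \<Rightarrow>\<^sub>0 'r::comm_ring_1)" where
  "smonom \<alpha> A \<beta> = sword \<alpha> * var (P A) * sstarword \<beta>"

context letter_subshift
begin

lemma act_sword:
  "act X (sword \<alpha>) \<phi> = (\<lambda>x k. if x \<in> X \<and> prefix (length \<alpha>) x = \<alpha>
     then \<phi> (suffix (length \<alpha>) x) (k - int (length \<alpha>)) else 0)"
proof (induction \<alpha>)
  case (Cons a \<alpha>)
  have "suffix (Suc 0) x \<in> X" if "x \<in> X" for x using that suffix_closed by blast
  then show ?case
    by (auto simp: fun_eq_iff sword_Cons act_mult act_var Cons.IH prefix_Suc_eq_Cons_iff algebra_simps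
        simp del: subseq_to_Suc)
qed (simp add: act_one fun_eq_iff)

lemma act_sstarword:
  "act X (sstarword \<beta>) \<phi> = (\<lambda>x k. if x \<in> X \<and> \<beta> \<frown> x \<in> X
     then \<phi> (\<beta> \<frown> x) (k + int (length \<beta>)) else 0)"
proof (induction \<beta> arbitrary: \<phi>)
  case (Cons b \<beta>)
  show ?case
    using sstarword_append[of "[b]" \<beta>, where 'b='b] build_tail
    by (auto simp: fun_eq_iff sstarword_letter act_mult act_var Cons.IH algebra_simps)
qed (auto simp: act_one fun_eq_iff)

lemma act_smonom:
  "act X (smonom \<alpha> A \<beta>) \<phi> = (\<lambda>x k. if x \<in> X \<and> prefix (length \<alpha>) x = \<alpha> \<and>
       suffix (length \<alpha>) x \<in> A \<and> \<beta> \<frown> suffix (length \<alpha>) x \<in> X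
     then \<phi> (\<beta> \<frown> suffix (length \<alpha>) x) (k - int (length \<alpha>) + int (length \<beta>)) else 0)"
  using suffix_closed by (auto simp: fun_eq_iff smonom_def act_mult act_sword act_sstarword act_var)

end

section \<open>Computing modulo the defining relations\<close>

locale letter_subshift_algebra = letter_subshift X for X :: "(nat \<Rightarrow> 'a) set" +
  fixes R :: "'r::field itself"
begin

abbreviation F :: "('a sgen mon \<Rightarrow>\<^sub>0 'r) ring" where "F \<equiv> free_algebra (sgens X)"
abbreviation I :: "('a sgen mon \<Rightarrow>\<^sub>0 'r) set" where "I \<equiv> relation_ideal X"
abbreviation B :: "('a sgen mon \<Rightarrow>\<^sub>0 'r) set ring" where "B \<equiv> subshift_algebra R X"
abbreviation p :: "(nat \<Rightarrow> 'a) set \<Rightarrow> ('a sgen mon \<Rightarrow>\<^sub>0 'r)" where "p A \<equiv> var (P A)"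
abbreviation s :: "'a \<Rightarrow> ('a sgen mon \<Rightarrow>\<^sub>0 'r)" where "s a \<equiv> var (S a)"
abbreviation t :: "'a \<Rightarrow> ('a sgen mon \<Rightarrow>\<^sub>0 'r)" where "t a \<equiv> var (Sstar a)"

sublocale F: ring F by (rule ring_free_algebra)

lemma F_ops [simp]: "x \<oplus>\<^bsub>F\<^esub> y = x + y" "x \<otimes>\<^bsub>F\<^esub> y = x * y" "\<zero>\<^bsub>F\<^esub> = 0" "\<one>\<^bsub>F\<^esub> = 1"
  by (simp_all add: free_algebra_def)

lemma carrier_F_iff: "f \<in> carrier F \<longleftrightarrow> (\<forall>w\<in>Poly_Mapping.keys f. set (letters w) \<subseteq> sgens X)"
  by (simp add: free_algebra_def)

lemma uminus_in_carrier: "f \<in> carrier F \<Longrightarrow> - f \<in> carrier F"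
  by (simp add: free_algebra_def)

lemma F_uminus: "f \<in> carrier F \<Longrightarrow> \<ominus>\<^bsub>F\<^esub> f = - f"
  by (rule F.minus_equality) (auto simp: uminus_in_carrier)

lemma F_minus: "f \<in> carrier F \<Longrightarrow> g \<in> carrier F \<Longrightarrow> f \<ominus>\<^bsub>F\<^esub> g = f - g"
  by (simp add: a_minus_def F_uminus)

lemma carrier_F_ops [simp, intro]:
  "f \<in> carrier F \<Longrightarrow> g \<in> carrier F \<Longrightarrow> f + g \<in> carrier F"
  "f \<in> carrier F \<Longrightarrow> g \<in> carrier F \<Longrightarrow> f * g \<in> carrier F"
  "f \<in> carrier F \<Longrightarrow> g \<in> carrier F \<Longrightarrow> f - g \<in> carrier F"
  "0 \<in> carrier F" "1 \<in> carrier F"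
proof -
  show "f + g \<in> carrier F" "f * g \<in> carrier F" if "f \<in> carrier F" "g \<in> carrier F"
    using F.a_closed[OF that] F.m_closed[OF that] by simp_all
  show "f - g \<in> carrier F" if "f \<in> carrier F" "g \<in> carrier F"
    using F.minus_closed[OF that] F_minus[OF that] by simp
  show "0 \<in> carrier F" "1 \<in> carrier F"
    using F.zero_closed F.one_closed by (simp_all del: F.zero_closed F.one_closed)
qed

lemma carrier_F_gens [simp, intro]:
  "A \<in> bool_alg X \<Longrightarrow> p A \<in> carrier F" "s a \<in> carrier F" "t a \<in> carrier F"
  "Poly_Mapping.single 0 c \<in> carrier F"
  unfolding carrier_F_iff by (auto simp: var_def sgens_def zero_mon_def)

lemma carrier_F_words [simp, intro]: "sword \<alpha> \<in> carrier F" "sstarword \<alpha> \<in> carrier F"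
proof -
  show "sword \<alpha> \<in> carrier F" by (induction \<alpha>) (auto simp: sword_Cons)
  show "sstarword \<alpha> \<in> carrier F"
    by (induction \<alpha> rule: rev_induct) (auto simp: sstarword_append sstarword_letter)
qed

lemma carrier_F_smonom [simp, intro]: "A \<in> bool_alg X \<Longrightarrow> smonom \<alpha> A \<beta> \<in> carrier F"
  by (auto simp: smonom_def)

lemma relators_subset: "relators X \<subseteq> carrier F"
  unfolding relators_def by (auto simp: bool_alg.Un bool_alg.Int)

sublocale I: ideal I F
  unfolding relation_ideal_def by (rule F.genideal_ideal[OF relators_subset])

lemma relators_in_I: "f \<in> relators X \<Longrightarrow> f \<in> I"
  unfolding relation_ideal_def using F.genideal_self[OF relators_subset] by auto

text \<open>Equality in the quotient, handled on representatives. Membership in the carrier is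
  included so that calculations chain with few side conditions.\<close>

definition eqv :: "('a sgen mon \<Rightarrow>\<^sub>0 'r) \<Rightarrow> ('a sgen mon \<Rightarrow>\<^sub>0 'r) \<Rightarrow> bool" (infix \<open>\<approx>\<close> 50) where
  "f \<approx> g \<longleftrightarrow> f \<in> carrier F \<and> g \<in> carrier F \<and> f - g \<in> I"

lemma I_add: "f \<in> I \<Longrightarrow> g \<in> I \<Longrightarrow> f + g \<in> I"
  using I.a_closed by simp

lemma I_uminus: "f \<in> I \<Longrightarrow> - f \<in> I"
  using I.a_inv_closed I.a_Hcarr F_uminus by metis

lemma eqv_refl: "f \<in> carrier F \<Longrightarrow> f \<approx> f"
  using I.zero_closed by (simp add: eqv_def)

lemma eqv_sym: "f \<approx> g \<Longrightarrow> g \<approx> f"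
  using I_uminus[of "f - g"] by (simp add: eqv_def)

lemma eqv_trans [trans]: "f \<approx> g \<Longrightarrow> g \<approx> h \<Longrightarrow> f \<approx> h"
  using I_add[of "f - g" "g - h"] by (simp add: eqv_def)

lemma eqv_add: "f \<approx> f' \<Longrightarrow> g \<approx> g' \<Longrightarrow> f + g \<approx> f' + g'"
  using I_add[of "f - f'" "g - g'"] by (auto simp: eqv_def algebra_simps)

lemma eqv_diff: "f \<approx> f' \<Longrightarrow> g \<approx> g' \<Longrightarrow> f - g \<approx> f' - g'"
  using I_add[of "f - f'" "- (g - g')"] I_uminus[of "g - g'"] by (auto simp: eqv_def algebra_simps)

lemma eqv_mult:
  assumes "f \<approx> f'" and "g \<approx> g'"
  shows "f * g \<approx> f' * g'"
proof -
  have "(f - f') * g \<in> I" using I.I_r_closed[of "f - f'" g] assms by (auto simp: eqv_def)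
  moreover have "f' * (g - g') \<in> I" using I.I_l_closed[of "g - g'" f'] assms by (auto simp: eqv_def)
  ultimately have "(f - f') * g + f' * (g - g') \<in> I" by (rule I_add)
  then show ?thesis using assms by (auto simp: eqv_def algebra_simps)
qed

lemma eqv_mult_left: "f \<approx> f' \<Longrightarrow> g \<in> carrier F \<Longrightarrow> g * f \<approx> g * f'"
  by (intro eqv_mult eqv_refl)

lemma eqv_mult_right: "f \<approx> f' \<Longrightarrow> g \<in> carrier F \<Longrightarrow> f * g \<approx> f' * g"
  by (intro eqv_mult eqv_refl)

lemma relation_eqv: "f - g \<in> relators X \<Longrightarrow> f \<in> carrier F \<Longrightarrow> g \<in> carrier F \<Longrightarrow> f \<approx> g"
  using relators_in_I by (simp add: eqv_def)

text \<open>The elements acting as zero form an ideal, so only the relators have to be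
  checked.\<close>

lemma act_I: "f \<in> I \<Longrightarrow> act X f \<phi> = (\<lambda>x k. 0)"
proof -
  let ?K = "{f \<in> carrier F. \<forall>\<phi>. act X f \<phi> = (\<lambda>x k. 0)}"
  have "ideal ?K F"
  proof (rule idealI)
    show "ring F" by (rule F.ring_axioms)
    show "subgroup ?K (add_monoid F)"
      by (rule F.add.subgroupI) (auto simp: F_uminus uminus_in_carrier act_uminus act_add
          simp flip: a_inv_def intro: exI[of _ 0])
    show "x \<otimes>\<^bsub>F\<^esub> f \<in> ?K" "f \<otimes>\<^bsub>F\<^esub> x \<in> ?K" if "f \<in> ?K" "x \<in> carrier F" for f x
      using that by (auto simp: act_mult act_arg_zero)
  qed
  moreover have "relators X \<subseteq> ?K"
  proof
    fix f :: "'a sgen mon \<Rightarrow>\<^sub>0 'r" assume f: "f \<in> relators X"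
    have "act X f \<phi> = (\<lambda>x k. 0)" for \<phi>
      using f unfolding relators_def
    proof (elim UnE)
      assume "f \<in> {sword \<beta> * sstarword \<alpha> * sword \<alpha> * sstarword \<beta> - var (P (cyl X \<alpha> \<beta>)) |\<alpha> \<beta>.
        \<alpha> \<in> language X \<and> \<beta> \<in> language X}"
      then obtain \<alpha> \<beta> where f: "f = sword \<beta> * sstarword \<alpha> * sword \<alpha> * sstarword \<beta> - var (P (cyl X \<alpha> \<beta>))"
        by auto
      \<comment> \<open>Read at \<open>x\<close>, the word product deletes the prefix
        \<open>\<beta>\<close>, tests whether \<open>\<alpha>\<close> can be put in front of the
        tail, and returns to \<open>x\<close>. Only this test survives, and it is membership in
        \<open>cyl X \<alpha> \<beta>\<close>.\<close>
      have "prefix (length \<beta>) x = \<beta> \<and> \<alpha> \<frown> suffix (length \<beta>) x \<in> X \<longleftrightarrow> x \<in> cyl X \<alpha> \<beta>" if "x \<in> X" for x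
        using that by (auto simp: cyl_def prefix_length_eq_iff)
      moreover have join: "\<beta> \<frown> suffix (length \<beta>) x = x" if "prefix (length \<beta>) x = \<beta>" for x
        using that by (metis prefix_suffix)
      ultimately have "act X f \<phi> x k = 0" for x k
        using suffix_closed[of x "length \<beta>"] join[of x]
        by (cases "prefix (length \<beta>) x = \<beta>")
          (auto simp: f act_diff act_mult act_sword act_sstarword act_var)
      then show ?thesis by (simp add: fun_eq_iff)
    qed (auto intro!: ext simp: act_diff act_add act_mult act_var act_one build_tail
        dest: suffix_closed[of _ "Suc 0"])
    then show "f \<in> ?K" using f relators_subset by auto
  qed
  ultimately have "I \<subseteq> ?K" unfolding relation_ideal_def by (rule F.genideal_minimal)
  then show "f \<in> I \<Longrightarrow> act X f \<phi> = (\<lambda>x k. 0)" by auto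
qed

lemma act_eqv: "f \<approx> g \<Longrightarrow> act X f = act X g"
  using act_I[of "f - g"] by (auto simp: eqv_def act_diff fun_eq_iff)

lemma p_X: "p X \<approx> 1"
  by (rule relation_eqv) ((unfold relators_def, blast), auto)

lemma p_empty: "p {} \<approx> 0"
  by (rule relation_eqv) (auto simp: relators_def)

lemma p_mult: "A \<in> bool_alg X \<Longrightarrow> C \<in> bool_alg X \<Longrightarrow> p A * p C \<approx> p (A \<inter> C)"
  by (rule eqv_sym, rule relation_eqv) ((unfold relators_def, blast), auto)

lemma p_Un: "A \<in> bool_alg X \<Longrightarrow> C \<in> bool_alg X \<Longrightarrow> p (A \<union> C) \<approx> p A + p C - p (A \<inter> C)"
  by (rule relation_eqv) ((unfold relators_def, blast), auto)

lemma p_disjoint_Un: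
  assumes "A \<in> bool_alg X" "C \<in> bool_alg X" "A \<inter> C = {}"
  shows "p (A \<union> C) \<approx> p A + p C"
proof -
  have "p A + p C - p (A \<inter> C) \<approx> p A + p C - 0"
    unfolding assms(3) using assms by (intro eqv_diff eqv_refl p_empty) auto
  then show ?thesis using eqv_trans[OF p_Un[OF assms(1,2)]] by simp
qed

lemma p_split:
  assumes "A \<in> bool_alg X" "C \<in> bool_alg X"
  shows "p C \<approx> p (C \<inter> A) + p (C - A)"
  using p_disjoint_Un[of "C \<inter> A" "C - A"] assms by (simp add: Int_Diff_Un disjoint_iff)

lemma sts: "s a * t a * s a \<approx> s a"
  by (rule relation_eqv) ((unfold relators_def, blast), auto)

lemma tst: "t a * s a * t a \<approx> t a"
  by (rule relation_eqv) ((unfold relators_def, blast), auto)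

lemma p_cyl: "\<alpha> \<in> language X \<Longrightarrow> \<beta> \<in> language X \<Longrightarrow>
    p (cyl X \<alpha> \<beta>) \<approx> sword \<beta> * sstarword \<alpha> * sword \<alpha> * sstarword \<beta>"
  by (rule eqv_sym, rule relation_eqv) ((unfold relators_def, blast), auto)

lemma ts: "t a * s a \<approx> p (cyl X [a] [])"
  using eqv_sym[OF p_cyl[of "[a]" "[]"]] by (simp add: sword_letter sstarword_letter)

lemma st: "s a * t a \<approx> p (cyl X [] [a])"
  using eqv_sym[OF p_cyl[of "[]" "[a]"]] by (simp add: sword_letter sstarword_letter)

end


section \<open>Normal form and faithfulness\<close>

context letter_subshift_algebra
begin

section \<open>Moving projections past letters and words\<close>

lemma p_commute: "A \<in> bool_alg X \<Longrightarrow> C \<in> bool_alg X \<Longrightarrow> p A * p C \<approx> p C * p A"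
  using eqv_trans[OF p_mult[of A C] eqv_sym[OF p_mult[of C A, unfolded Int_commute[of C A]]]] by simp

lemma p_diff:
  assumes "A \<in> bool_alg X" "C \<in> bool_alg X" "A \<subseteq> C"
  shows "p (C - A) \<approx> p C - p A"
proof -
  have "C \<inter> A = A" using assms by auto
  then have "p C - p A \<approx> (p A + p (C - A)) - p A"
    using eqv_diff[OF p_split[OF assms(1,2)] eqv_refl[of "p A"]] assms by simp
  then show ?thesis by (simp add: eqv_sym)
qed

lemma p_s_range: "p (cyl X [] [a]) * s a \<approx> s a"
  using eqv_trans[OF eqv_mult_right[OF eqv_sym[OF st]] sts] by simp

lemma s_p_source: "s a * p (cyl X [a] []) \<approx> s a"
  using eqv_trans[OF eqv_mult_left[OF eqv_sym[OF ts], of "s a"]] sts by (simp add: mult.assoc)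

lemma t_p_range: "t a * p (cyl X [] [a]) \<approx> t a"
  using eqv_trans[OF eqv_mult_left[OF eqv_sym[OF st], of "t a"]] tst by (simp add: mult.assoc)

lemma p_t_source: "p (cyl X [a] []) * t a \<approx> t a"
  using eqv_trans[OF eqv_mult_right[OF eqv_sym[OF ts]] tst] by simp

lemma p_s_restrict:
  assumes "A \<in> bool_alg X"
  shows "p A * s a \<approx> p (A \<inter> cyl X [] [a]) * s a"
proof -
  have "p A * s a \<approx> p A * (p (cyl X [] [a]) * s a)"
    using assms by (intro eqv_mult_left eqv_sym[OF p_s_range]) auto
  also have "\<dots> = (p A * p (cyl X [] [a])) * s a" by (simp add: mult.assoc)
  also have "\<dots> \<approx> p (A \<inter> cyl X [] [a]) * s a"
    using assms by (intro eqv_mult_right p_mult) auto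
  finally show ?thesis .
qed

text \<open>Both sides vanish. \<open>C\<close> is kept as a variable so that a pulled-back set
  found to be empty can be inserted.\<close>

lemma p_s_zero:
  assumes "A \<in> bool_alg X" and "A \<inter> cyl X [] [a] = {}" and "C = {}"
  shows "p A * s a \<approx> s a * p C"
proof -
  have "p A * s a \<approx> p {} * s a" using p_s_restrict[OF assms(1)] assms(2) by metis
  also have "\<dots> \<approx> 0 * s a" by (intro eqv_mult_right p_empty) auto
  also have "0 * s a = s a * 0" by simp
  also have "s a * 0 \<approx> s a * p C" unfolding assms(3) by (intro eqv_mult_left eqv_sym[OF p_empty]) auto
  finally show ?thesis .
qed

text \<open>The commutation rule is not among the relations; for generators it follows by writing
  the projection as a product of words. If \<open>\<beta>\<close> is empty, the words for
  \<open>\<alpha> @ [a]\<close> split off the range projection \<open>s a * t a\<close>, which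
  commutes with \<open>p (cyl X \<alpha> [])\<close> and is absorbed by \<open>s a\<close>. If
  \<open>\<beta>\<close> begins with \<open>a\<close>, that letter meets \<open>s a\<close> and
  leaves its source projection.\<close>

lemma p_cyl_s:
  assumes "\<alpha> \<in> language X" and "\<beta> \<in> language X"
  shows "p (cyl X \<alpha> \<beta>) * s a \<approx> s a * p (pull (cyl X \<alpha> \<beta>) [a])"
proof (cases \<beta>)
  case Nil
  let ?C = "cyl X [a] []" and ?Z = "cyl X [] [a]" and ?A = "cyl X \<alpha> []" and ?D = "cyl X (\<alpha> @ [a]) []"
  have pull: "pull ?A [a] = ?C \<inter> ?D" by (simp add: pull_cyl)
  show ?thesis
  \<comment> \<open>The word relation speaks only of words in the language. For other words
    \<open>\<alpha> @ [a]\<close> no point of \<open>X\<close> has this prefix, and both sides are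
    zero.\<close>
  proof (cases "\<alpha> @ [a] \<in> language X")
    case True
    have "s a * p (?C \<inter> ?D) \<approx> s a * (p ?C * p ?D)"
      by (intro eqv_mult_left eqv_sym[OF p_mult]) auto
    also have "\<dots> = (s a * p ?C) * p ?D" by (simp add: mult.assoc)
    also have "\<dots> \<approx> s a * (sstarword (\<alpha> @ [a]) * sword (\<alpha> @ [a]))"
      using p_cyl[OF True Nil_in_language] by (intro eqv_mult s_p_source) auto
    also have "\<dots> = (s a * t a) * (sstarword \<alpha> * sword \<alpha>) * s a"
      by (simp add: sword_append sstarword_append sword_letter sstarword_letter mult.assoc)
    also have "\<dots> \<approx> p ?Z * p ?A * s a"
      using eqv_sym[OF p_cyl[OF assms(1) Nil_in_language]]
      by (intro eqv_mult_right[of _ _ "s a"] eqv_mult st) auto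
    also have "\<dots> \<approx> p ?A * p ?Z * s a"
      by (intro eqv_mult_right p_commute) auto
    also have "\<dots> = p ?A * (p ?Z * s a)" by (simp add: mult.assoc)
    also have "\<dots> \<approx> p ?A * s a" by (intro eqv_mult_left p_s_range) auto
    finally show ?thesis unfolding Nil pull by (rule eqv_sym)
  next
    case False
    have no: "\<alpha> \<frown> a ## w \<notin> X" for w
      using False prefix_in_language[of "\<alpha> @ [a]" w] by auto
    have "pull ?A [a] = {}" "?A \<inter> ?Z = {}" using no by (auto simp: pull_def cyl_def)
    then show ?thesis unfolding Nil by (intro p_s_zero) auto
  qed
next
  case (Cons b \<beta>')
  have b': "\<beta>' \<in> language X" using language_Cons assms(2) Cons by metis
  show ?thesis
  proof (cases "a = b")
    case True
    let ?Y = "sword \<beta>' * sstarword \<alpha> * sword \<alpha> * sstarword \<beta>'"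
    have "p (cyl X \<alpha> \<beta>) * s a \<approx> (s a * ?Y * t a) * s a"
      using p_cyl[OF assms] Cons True
      by (intro eqv_mult_right) (auto simp: sword_Cons sstarword_Cons mult.assoc)
    also have "\<dots> = s a * (?Y * (t a * s a))" by (simp add: mult.assoc)
    also have "\<dots> \<approx> s a * (p (cyl X \<alpha> \<beta>') * p (cyl X [a] []))"
      by (intro eqv_mult_left eqv_mult ts eqv_sym[OF p_cyl] assms b') auto
    also have "\<dots> \<approx> s a * p (cyl X \<alpha> \<beta>' \<inter> cyl X [a] [])"
      by (intro eqv_mult_left p_mult) auto
    also have "cyl X \<alpha> \<beta>' \<inter> cyl X [a] [] = pull (cyl X \<alpha> \<beta>) [a]"
      using Cons True by (auto simp: pull_cyl)
    finally show ?thesis .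
  next
    case False
    have "pull (cyl X \<alpha> \<beta>) [a] = {}" "cyl X \<alpha> \<beta> \<inter> cyl X [] [a] = {}"
      using Cons False by (simp add: pull_cyl, auto simp: cyl_def)
    then show ?thesis by (intro p_s_zero) auto
  qed
qed

lemma p_s_Int:
  assumes U: "A \<in> bool_alg X" "C \<in> bool_alg X"
    and A: "p A * s a \<approx> s a * p (pull A [a])" and C: "p C * s a \<approx> s a * p (pull C [a])"
  shows "p (A \<inter> C) * s a \<approx> s a * p (pull (A \<inter> C) [a])"
proof -
  have "p (A \<inter> C) * s a \<approx> p A * p C * s a"
    using U by (intro eqv_mult_right eqv_sym[OF p_mult]) auto
  also have "\<dots> = p A * (p C * s a)" by (simp add: mult.assoc)
  also have "\<dots> \<approx> p A * (s a * p (pull C [a]))" using U by (intro eqv_mult_left C) auto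
  also have "\<dots> = (p A * s a) * p (pull C [a])" by (simp add: mult.assoc)
  also have "\<dots> \<approx> (s a * p (pull A [a])) * p (pull C [a])" using U by (intro eqv_mult_right A) auto
  also have "\<dots> = s a * (p (pull A [a]) * p (pull C [a]))" by (simp add: mult.assoc)
  also have "\<dots> \<approx> s a * p (pull A [a] \<inter> pull C [a])" using U by (intro eqv_mult_left p_mult) auto
  also have "pull A [a] \<inter> pull C [a] = pull (A \<inter> C) [a]" by (auto simp: pull_def)
  finally show ?thesis .
qed

text \<open>The sets obeying the rule are closed under the Boolean operations. In the complement
  step the unit \<open>p X\<close> contributes \<open>s a\<close>, which is rewritten with its
  source projection before the difference is taken.\<close>

lemma p_s: "A \<in> bool_alg X \<Longrightarrow> p A * s a \<approx> s a * p (pull A [a])"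
proof (induction rule: bool_alg.induct)
  case (gen \<alpha> \<beta>)
  then show ?case by (rule p_cyl_s)
next
  case (Int A C)
  then show ?case by (rule p_s_Int)
next
  case (Un A C)
  have U: "pull A [a] \<in> bool_alg X" "pull C [a] \<in> bool_alg X" using Un by auto
  have "p (A \<union> C) * s a \<approx> (p A + p C - p (A \<inter> C)) * s a"
    using Un by (intro eqv_mult_right p_Un) auto
  also have "\<dots> = p A * s a + p C * s a - p (A \<inter> C) * s a" by (simp add: algebra_simps)
  also have "\<dots> \<approx> s a * p (pull A [a]) + s a * p (pull C [a]) - s a * p (pull (A \<inter> C) [a])"
    using Un by (intro eqv_add eqv_diff p_s_Int) auto
  also have "\<dots> = s a * (p (pull A [a]) + p (pull C [a]) - p (pull (A \<inter> C) [a]))"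
    by (simp add: algebra_simps)
  also have "pull (A \<inter> C) [a] = pull A [a] \<inter> pull C [a]" by (auto simp: pull_def)
  also have "s a * (p (pull A [a]) + p (pull C [a]) - p (pull A [a] \<inter> pull C [a]))
      \<approx> s a * p (pull A [a] \<union> pull C [a])"
    using U by (intro eqv_mult_left eqv_sym[OF p_Un]) auto
  also have "pull A [a] \<union> pull C [a] = pull (A \<union> C) [a]" by (auto simp: pull_def)
  finally show ?case .
next
  case (compl A)
  let ?C = "cyl X [a] []"
  have sub: "pull A [a] \<subseteq> ?C" using bool_alg_subset[OF compl(1)] by (auto simp: pull_def cyl_def dest: build_tail)
  have "p (X - A) * s a \<approx> (p X - p A) * s a"
    using compl bool_alg_subset by (intro eqv_mult_right p_diff) auto
  also have "\<dots> = p X * s a - p A * s a" by (simp add: algebra_simps)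
  also have "\<dots> \<approx> 1 * s a - s a * p (pull A [a])"
    using compl by (intro eqv_diff eqv_mult_right p_X) auto
  also have "\<dots> = s a - s a * p (pull A [a])" by simp
  also have "\<dots> \<approx> s a * p ?C - s a * p (pull A [a])"
    using compl by (intro eqv_diff eqv_sym[OF s_p_source] eqv_refl) auto
  also have "\<dots> = s a * (p ?C - p (pull A [a]))" by (simp add: algebra_simps)
  also have "\<dots> \<approx> s a * p (?C - pull A [a])"
    using compl sub by (intro eqv_mult_left eqv_sym[OF p_diff]) auto
  also have "?C - pull A [a] = pull (X - A) [a]" by (auto simp: pull_def cyl_def dest: build_tail)
  finally show ?case .
qed

text \<open>Obtained from \<open>p_s\<close>: insert the range projection \<open>s a * t a\<close>
  to the right of \<open>p A\<close>, pull \<open>p A\<close> through \<open>s a\<close>, and absorb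
  the remaining \<open>t a * s a\<close> into the final \<open>t a\<close>.\<close>

lemma t_p:
  assumes U: "A \<in> bool_alg X"
  shows "t a * p A \<approx> p (pull A [a]) * t a"
proof -
  let ?Z = "cyl X [] [a]" and ?C = "cyl X [a] []"
  have "t a * p A \<approx> (t a * p ?Z) * p A" using U by (intro eqv_mult_right eqv_sym[OF t_p_range]) auto
  also have "\<dots> = t a * (p ?Z * p A)" by (simp add: mult.assoc)
  also have "\<dots> \<approx> t a * (p A * p ?Z)" using U by (intro eqv_mult_left p_commute) auto
  also have "\<dots> \<approx> t a * (p A * (s a * t a))"
    using U by (intro eqv_mult_left eqv_sym[OF st]) auto
  also have "\<dots> = t a * (p A * s a) * t a" by (simp add: mult.assoc)
  also have "\<dots> \<approx> t a * (s a * p (pull A [a])) * t a"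
    using U by (intro eqv_mult_right eqv_mult_left p_s) auto
  also have "\<dots> = (t a * s a) * p (pull A [a]) * t a" by (simp add: mult.assoc)
  also have "\<dots> \<approx> p ?C * p (pull A [a]) * t a" using U by (intro eqv_mult_right ts) auto
  also have "\<dots> \<approx> p (pull A [a]) * p ?C * t a" using U by (intro eqv_mult_right p_commute) auto
  also have "\<dots> = p (pull A [a]) * (p ?C * t a)" by (simp add: mult.assoc)
  also have "\<dots> \<approx> p (pull A [a]) * t a" using U by (intro eqv_mult_left p_t_source) auto
  finally show ?thesis .
qed

text \<open>The pushed set lies in the range of \<open>a\<close>, so its projection may be
  multiplied by \<open>s a * t a\<close>. Pulling it through \<open>s a\<close> gives back
  \<open>A\<close> up to the source projection of \<open>s a\<close>.\<close>

lemma s_p_t: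
  assumes U: "A \<in> bool_alg X"
  shows "s a * p A * t a \<approx> p (push a X A)"
proof -
  let ?Z = "cyl X [] [a]" and ?C = "cyl X [a] []"
  have pull: "pull (push a X A) [a] = ?C \<inter> A"
    using bool_alg_subset[OF U] by (auto simp: pull_def push_def cyl_def)
  have "p (push a X A) \<approx> p (push a X A \<inter> ?Z)"
  proof -
    have "push a X A = push a X A \<inter> ?Z" by (auto simp: push_def cyl_def dest: build_tail)
    then show ?thesis using U by (metis eqv_refl carrier_F_gens(1) push_in_bool_alg)
  qed
  also have "\<dots> \<approx> p (push a X A) * p ?Z" using U by (intro eqv_sym[OF p_mult]) auto
  also have "\<dots> \<approx> p (push a X A) * (s a * t a)" using U by (intro eqv_mult_left eqv_sym[OF st]) auto
  also have "\<dots> = (p (push a X A) * s a) * t a" by (simp add: mult.assoc)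
  also have "\<dots> \<approx> (s a * p (?C \<inter> A)) * t a"
    using p_s[of "push a X A" a] U unfolding pull by (intro eqv_mult_right) auto
  also have "\<dots> \<approx> (s a * (p ?C * p A)) * t a"
    using U by (intro eqv_mult_right eqv_mult_left eqv_sym[OF p_mult]) auto
  also have "\<dots> = (s a * p ?C) * (p A * t a)" by (simp add: mult.assoc)
  also have "\<dots> \<approx> s a * (p A * t a)" using U by (intro eqv_mult_right s_p_source) auto
  finally show ?thesis by (simp add: eqv_sym mult.assoc)
qed

lemma p_sword:
  "A \<in> bool_alg X \<Longrightarrow> p A * sword \<alpha> \<approx> sword \<alpha> * p (pull A \<alpha>)"
proof (induction \<alpha> arbitrary: A)
  case (Cons a \<alpha>)
  have "p A * sword (a # \<alpha>) = (p A * s a) * sword \<alpha>" by (simp add: sword_Cons mult.assoc)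
  also have "\<dots> \<approx> (s a * p (pull A [a])) * sword \<alpha>" using Cons by (intro eqv_mult_right p_s) auto
  also have "\<dots> = s a * (p (pull A [a]) * sword \<alpha>)" by (simp add: mult.assoc)
  also have "\<dots> \<approx> s a * (sword \<alpha> * p (pull (pull A [a]) \<alpha>))" using Cons by (intro eqv_mult_left) auto
  finally show ?case by (simp add: sword_Cons mult.assoc pull_Cons[of A a \<alpha>])
qed (auto intro: eqv_refl)

lemma sstarword_p:
  "A \<in> bool_alg X \<Longrightarrow> sstarword \<alpha> * p A \<approx> p (pull A \<alpha>) * sstarword \<alpha>"
proof (induction \<alpha> arbitrary: A)
  case (Cons a \<alpha>)
  have "sstarword (a # \<alpha>) * p A = sstarword \<alpha> * (t a * p A)" by (simp add: sstarword_Cons mult.assoc)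
  also have "\<dots> \<approx> sstarword \<alpha> * (p (pull A [a]) * t a)" using Cons by (intro eqv_mult_left t_p) auto
  also have "\<dots> = (sstarword \<alpha> * p (pull A [a])) * t a" by (simp add: mult.assoc)
  also have "\<dots> \<approx> (p (pull (pull A [a]) \<alpha>) * sstarword \<alpha>) * t a" using Cons by (intro eqv_mult_right) auto
  finally show ?case by (simp add: sstarword_Cons mult.assoc pull_Cons[of A a \<alpha>])
qed (auto intro: eqv_refl)

section \<open>Bringing monomials into canonical form\<close>

lemma p_smonom:
  assumes "A \<in> bool_alg X" and "C \<in> bool_alg X"
  shows "p C * smonom \<alpha> A \<beta> \<approx> smonom \<alpha> (pull C \<alpha> \<inter> A) \<beta>"
proof -
  have "p C * smonom \<alpha> A \<beta> = (p C * sword \<alpha>) * p A * sstarword \<beta>" by (simp add: smonom_def mult.assoc)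
  also have "\<dots> \<approx> (sword \<alpha> * p (pull C \<alpha>)) * p A * sstarword \<beta>"
    using assms by (intro eqv_mult_right p_sword) auto
  also have "\<dots> = sword \<alpha> * (p (pull C \<alpha>) * p A) * sstarword \<beta>" by (simp add: mult.assoc)
  also have "\<dots> \<approx> sword \<alpha> * p (pull C \<alpha> \<inter> A) * sstarword \<beta>"
    using assms by (intro eqv_mult_right eqv_mult_left p_mult) auto
  finally show ?thesis by (simp add: smonom_def)
qed

lemma smonom_p:
  assumes "A \<in> bool_alg X" and "C \<in> bool_alg X"
  shows "smonom \<alpha> A \<beta> * p C \<approx> smonom \<alpha> (A \<inter> pull C \<beta>) \<beta>"
proof -
  have "smonom \<alpha> A \<beta> * p C = sword \<alpha> * p A * (sstarword \<beta> * p C)" by (simp add: smonom_def mult.assoc)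
  also have "\<dots> \<approx> sword \<alpha> * p A * (p (pull C \<beta>) * sstarword \<beta>)"
    using assms by (intro eqv_mult_left sstarword_p) auto
  also have "\<dots> = sword \<alpha> * (p A * p (pull C \<beta>)) * sstarword \<beta>" by (simp add: mult.assoc)
  also have "\<dots> \<approx> sword \<alpha> * p (A \<inter> pull C \<beta>) * sstarword \<beta>"
    using assms by (intro eqv_mult_right eqv_mult_left p_mult) auto
  finally show ?thesis by (simp add: smonom_def)
qed

text \<open>The star of a letter passes the projection and joins \<open>\<beta>\<close> if
  \<open>\<alpha>\<close> is empty, turns into a source projection against the same first letter,
  and gives zero against a different one because the two ranges are disjoint.\<close>

lemma t_smonom:
  assumes A: "A \<in> bool_alg X"
  shows "\<exists>\<alpha>' A' \<beta>'. A' \<in> bool_alg X \<and> t a * smonom \<alpha> A \<beta> \<approx> smonom \<alpha>' A' \<beta>'"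
proof (cases \<alpha>)
  case Nil
  have "t a * smonom \<alpha> A \<beta> = (t a * p A) * sstarword \<beta>" by (simp add: Nil smonom_def mult.assoc)
  also have "\<dots> \<approx> (p (pull A [a]) * t a) * sstarword \<beta>"
    using A by (intro eqv_mult_right t_p) auto
  also have "\<dots> = smonom [] (pull A [a]) (\<beta> @ [a])"
    by (simp add: smonom_def sstarword_append sstarword_letter mult.assoc)
  finally show ?thesis using A by (metis pull_in_bool_alg)
next
  case (Cons c \<gamma>)
  show ?thesis
  proof (cases "c = a")
    case True
    have "t a * smonom \<alpha> A \<beta> = (t a * s a) * smonom \<gamma> A \<beta>"
      by (simp add: Cons True smonom_def sword_Cons mult.assoc)
    also have "\<dots> \<approx> p (cyl X [a] []) * smonom \<gamma> A \<beta>" using A by (intro eqv_mult_right ts) auto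
    also have "\<dots> \<approx> smonom \<gamma> (pull (cyl X [a] []) \<gamma> \<inter> A) \<beta>" using A by (intro p_smonom) auto
    finally show ?thesis using A by (metis pull_in_bool_alg bool_alg.Int cyl_in_bool_alg)
  next
    case False
    have disj: "cyl X [] [a] \<inter> cyl X [] [c] = {}" using False by (auto simp: cyl_def)
    have "t a * s c \<approx> (t a * p (cyl X [] [a])) * s c" by (intro eqv_mult_right eqv_sym[OF t_p_range]) auto
    also have "\<dots> = t a * (p (cyl X [] [a]) * s c)" by (simp add: mult.assoc)
    also have "\<dots> \<approx> t a * (s c * p {})"
      by (intro eqv_mult_left p_s_zero disj) auto
    also have "\<dots> \<approx> t a * (s c * 0)" by (intro eqv_mult_left p_empty) auto
    finally have ts0: "t a * s c \<approx> 0" by simp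
    have "t a * smonom \<alpha> A \<beta> = (t a * s c) * (smonom \<gamma> A \<beta>)"
      by (simp add: Cons smonom_def sword_Cons mult.assoc)
    also have "\<dots> \<approx> 0 * smonom \<gamma> A \<beta>" using A by (intro eqv_mult_right ts0) auto
    also have "\<dots> = 0" by simp
    \<comment> \<open>Zero is kept as a monomial with the empty set, so that the shape is preserved
      in every case.\<close>
    also have "0 \<approx> smonom [] {} []" using eqv_sym[OF p_empty] by (simp add: smonom_def)
    finally show ?thesis using empty_in_bool_alg by blast
  qed
qed

lemma monomial_eqv_smonom:
  "set w \<subseteq> sgens X \<Longrightarrow>
    \<exists>\<alpha> A \<beta>. A \<in> bool_alg X \<and> Poly_Mapping.single (Mon w) 1 \<approx> smonom \<alpha> A \<beta>"
proof (induction w)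
  case Nil
  have "Poly_Mapping.single (Mon []) 1 = (1 :: 'a sgen mon \<Rightarrow>\<^sub>0 'r)"
    by (simp flip: single_one add: zero_mon_def)
  then have "Poly_Mapping.single (Mon []) 1 \<approx> smonom [] X []"
    using eqv_sym[OF p_X] by (simp add: smonom_def)
  then show ?case using X_in_bool_alg by blast
next
  case (Cons g w)
  then obtain \<alpha> A \<beta> where IH: "A \<in> bool_alg X" "Poly_Mapping.single (Mon w) 1 \<approx> smonom \<alpha> A \<beta>" by auto
  have "g \<in> P ` bool_alg X \<or> g \<in> range S \<or> g \<in> range Sstar"
    using Cons.prems by (auto simp: sgens_def)
  then have g: "var g \<in> carrier F" by auto
  have "Poly_Mapping.single (Mon (g # w)) 1 = var g * Poly_Mapping.single (Mon w) 1"
    by (simp add: var_def mult_single plus_mon_def)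
  also have "\<dots> \<approx> var g * smonom \<alpha> A \<beta>" using IH g by (intro eqv_mult_left) auto
  finally have *: "Poly_Mapping.single (Mon (g # w)) 1 \<approx> var g * smonom \<alpha> A \<beta>" .
  have "\<exists>\<alpha>' A' \<beta>'. A' \<in> bool_alg X \<and> var g * smonom \<alpha> A \<beta> \<approx> smonom \<alpha>' A' \<beta>'"
  proof (cases g)
    case (P C)
    then have "C \<in> bool_alg X" using Cons.prems by (auto simp: sgens_def)
    then show ?thesis unfolding P using IH p_smonom by (metis bool_alg.Int pull_in_bool_alg)
  next
    case (S a)
    have "s a * smonom \<alpha> A \<beta> \<approx> smonom (a # \<alpha>) A \<beta>"
      using IH eqv_refl[of "smonom (a # \<alpha>) A \<beta>"] by (simp add: smonom_def sword_Cons mult.assoc)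
    then show ?thesis unfolding S using IH by blast
  next
    case (Sstar a)
    then show ?thesis using t_smonom IH by simp
  qed
  then show ?case using eqv_trans[OF *] by blast
qed

text \<open>The last condition removes from \<open>A\<close> the tails on which the monomial acts as
  zero; the operator then determines \<open>A\<close>.\<close>

definition canonical :: "'a list \<Rightarrow> (nat \<Rightarrow> 'a) set \<Rightarrow> 'a list \<Rightarrow> bool" where
  "canonical \<alpha> A \<beta> \<longleftrightarrow> reduced \<alpha> \<beta> \<and> A \<in> bool_alg X \<and> A \<subseteq> pull X \<alpha> \<inter> pull X \<beta>"

text \<open>A common last letter of the two words is contracted into the set by
  \<open>s_p_t\<close>; this shortens \<open>\<alpha>\<close> and is repeated until the last letters
  differ or a word is empty.\<close>

lemma smonom_eqv_reduced:
  "A \<in> bool_alg X \<Longrightarrow> \<exists>\<alpha>' A' \<beta>'. A' \<in> bool_alg X \<and> reduced \<alpha>' \<beta>' \<and> smonom \<alpha> A \<beta> \<approx> smonom \<alpha>' A' \<beta>'"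
proof (induction \<alpha> arbitrary: A \<beta> rule: rev_induct)
  case Nil
  then show ?case using eqv_refl[of "smonom [] A \<beta>"] unfolding reduced_def by blast
next
  case (snoc a \<alpha>)
  show ?case
  proof (cases "reduced (\<alpha> @ [a]) \<beta>")
    case True
    then show ?thesis using eqv_refl[of "smonom (\<alpha> @ [a]) A \<beta>"] snoc.prems by blast
  next
    case False
    then obtain \<beta>' where b: "\<beta> = \<beta>' @ [a]"
      unfolding reduced_def by (metis append_butlast_last_id last_snoc)
    have "smonom (\<alpha> @ [a]) A \<beta> = sword \<alpha> * (s a * p A * t a) * sstarword \<beta>'"
      by (simp add: smonom_def b sword_append sstarword_append sword_letter sstarword_letter mult.assoc)
    also have "\<dots> \<approx> sword \<alpha> * p (push a X A) * sstarword \<beta>'"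
      using snoc.prems by (intro eqv_mult_right eqv_mult_left s_p_t) auto
    also have "\<dots> = smonom \<alpha> (push a X A) \<beta>'" by (simp add: smonom_def)
    finally have *: "smonom (\<alpha> @ [a]) A \<beta> \<approx> smonom \<alpha> (push a X A) \<beta>'" .
    show ?thesis using snoc.IH[OF push_in_bool_alg[OF snoc.prems]] eqv_trans[OF *] by blast
  qed
qed

text \<open>Multiplying by the unit \<open>p X\<close> on the left and on the right cuts the set
  down to tails that both words can precede, without touching the words.\<close>

lemma smonom_eqv_canonical:
  assumes "A \<in> bool_alg X"
  shows "\<exists>\<alpha>' A' \<beta>'. canonical \<alpha>' A' \<beta>' \<and> smonom \<alpha> A \<beta> \<approx> smonom \<alpha>' A' \<beta>'"
proof -
  obtain \<alpha>' A' \<beta>' where r: "A' \<in> bool_alg X" "reduced \<alpha>' \<beta>'" "smonom \<alpha> A \<beta> \<approx> smonom \<alpha>' A' \<beta>'"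
    using smonom_eqv_reduced[OF assms] by blast
  let ?A = "pull X \<alpha>' \<inter> A'"
  have "smonom \<alpha>' A' \<beta>' \<approx> p X * smonom \<alpha>' A' \<beta>'"
    using r eqv_mult_right[OF eqv_sym[OF p_X], of "smonom \<alpha>' A' \<beta>'"] by simp
  also have "\<dots> \<approx> smonom \<alpha>' ?A \<beta>'" using r by (intro p_smonom) auto
  also have "\<dots> \<approx> smonom \<alpha>' ?A \<beta>' * p X"
    using r eqv_mult_left[OF eqv_sym[OF p_X], of "smonom \<alpha>' ?A \<beta>'"] by simp
  also have "\<dots> \<approx> smonom \<alpha>' (?A \<inter> pull X \<beta>') \<beta>'" using r by (intro smonom_p) auto
  finally have "smonom \<alpha> A \<beta> \<approx> smonom \<alpha>' (?A \<inter> pull X \<beta>') \<beta>'" using eqv_trans[OF r(3)] by blast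
  moreover have "canonical \<alpha>' (?A \<inter> pull X \<beta>') \<beta>'" using r unfolding canonical_def by auto
  ultimately show ?thesis by blast
qed

section \<open>Linear combinations of monomials and faithfulness\<close>

type_synonym ('b, 'c) summand = "'c \<times> 'b list \<times> (nat \<Rightarrow> 'b) set \<times> 'b list"

text \<open>A pair \<open>(\<alpha>, \<beta>)\<close> may occur in several summands, with
  overlapping sets, so this is no unique normal form; \<open>lsum_eqv_zero\<close> collects the
  summands by pairs.\<close>

definition lsum :: "('a, 'r) summand list \<Rightarrow> ('a sgen mon \<Rightarrow>\<^sub>0 'r)" where
  "lsum l = (\<Sum>(c, \<alpha>, A, \<beta>)\<leftarrow>l. Poly_Mapping.single 0 c * smonom \<alpha> A \<beta>)"

definition normal :: "('a, 'r) summand list \<Rightarrow> bool" where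
  "normal l \<longleftrightarrow> (\<forall>(c, \<alpha>, A, \<beta>)\<in>set l. canonical \<alpha> A \<beta>)"

lemma lsum_simps [simp]:
  "lsum [] = 0" "lsum ((c, \<alpha>, A, \<beta>) # l) = Poly_Mapping.single 0 c * smonom \<alpha> A \<beta> + lsum l"
  by (simp_all add: lsum_def)

lemma normal_simps [simp]:
  "normal []" "normal ((c, \<alpha>, A, \<beta>) # l) \<longleftrightarrow> canonical \<alpha> A \<beta> \<and> normal l"
  by (simp_all add: normal_def ball_Un)

lemma lsum_carrier [simp]: "normal l \<Longrightarrow> lsum l \<in> carrier F"
  by (induction l) (auto simp: canonical_def)

lemma eqv_lsum:
  assumes "f \<in> carrier F"
  shows "\<exists>l. normal l \<and> f \<approx> lsum l"
proof -
  have "\<exists>l. normal l \<and> (\<Sum>w\<in>W. Poly_Mapping.single w (Poly_Mapping.lookup f w)) \<approx> lsum l"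
    if "finite W" "W \<subseteq> Poly_Mapping.keys f" for W
    using that
  proof (induction W rule: finite_induct)
    case empty
    have "normal [] \<and> 0 \<approx> lsum []" using eqv_refl[of 0] by simp
    then show ?case by (intro exI[of _ "[]"]) simp
  next
    case (insert w W)
    then obtain l where l: "normal l"
      "(\<Sum>w\<in>W. Poly_Mapping.single w (Poly_Mapping.lookup f w)) \<approx> lsum l" by auto
    have "set (letters w) \<subseteq> sgens X" using assms insert unfolding carrier_F_iff by auto
    then obtain \<alpha> A \<beta> where "A \<in> bool_alg X"
      and m: "Poly_Mapping.single (Mon (letters w)) 1 \<approx> smonom \<alpha> A \<beta>"
      using monomial_eqv_smonom by blast
    then obtain \<alpha>' A' \<beta>' where c: "canonical \<alpha>' A' \<beta>'" "smonom \<alpha> A \<beta> \<approx> smonom \<alpha>' A' \<beta>'"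
      using smonom_eqv_canonical by blast
    let ?c = "Poly_Mapping.lookup f w"
    have "Poly_Mapping.single w ?c = Poly_Mapping.single 0 ?c * Poly_Mapping.single (Mon (letters w)) 1"
      by (simp add: mult_single)
    also have "\<dots> \<approx> Poly_Mapping.single 0 ?c * smonom \<alpha>' A' \<beta>'"
      by (intro eqv_mult_left eqv_trans[OF m c(2)]) auto
    finally have "(\<Sum>w\<in>insert w W. Poly_Mapping.single w (Poly_Mapping.lookup f w))
        \<approx> lsum ((?c, \<alpha>', A', \<beta>') # l)"
      using insert.hyps l by (simp add: eqv_add)
    then show ?case using l c by (metis normal_simps(2))
  qed
  then show ?thesis using poly_mapping_eq_sum_single[of f] by (metis finite_keys subset_refl)
qed

lemma simple_function_carrier:
  "\<forall>(c, A)\<in>set l. A \<in> bool_alg X \<Longrightarrow> (\<Sum>(c, A)\<leftarrow>l. Poly_Mapping.single 0 c * p A) \<in> carrier F"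
  by (induction l) auto

text \<open>The induction splits \<open>C\<close> along the sets in \<open>l\<close>; \<open>\<mu>\<close> collects the coefficients of the
  sets already known to contain the current piece.\<close>

lemma simple_function_eqv_zero:
  "(\<forall>(c, A)\<in>set l. A \<in> bool_alg X) \<Longrightarrow> C \<in> bool_alg X \<Longrightarrow>
    (\<forall>x\<in>C. \<mu> + (\<Sum>(c, A)\<leftarrow>l. if x \<in> A then c else 0) = 0) \<Longrightarrow>
    (Poly_Mapping.single 0 \<mu> + (\<Sum>(c, A)\<leftarrow>l. Poly_Mapping.single 0 c * p A)) * p C \<approx> 0"
proof (induction l arbitrary: C \<mu>)
  case Nil
  show ?case
  proof (cases "C = {}")
    case True
    have "Poly_Mapping.single 0 \<mu> * p {} \<approx> Poly_Mapping.single 0 \<mu> * 0"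
      by (intro eqv_mult_left p_empty) auto
    then show ?thesis using True by simp
  next
    case False
    then have "\<mu> = 0" using Nil by auto
    then show ?thesis using eqv_refl[of 0] by simp
  qed
next
  case (Cons cA l)
  obtain c A where cA: "cA = (c, A)" by force
  have U: "A \<in> bool_alg X" "C \<in> bool_alg X" and l: "\<forall>(c, A)\<in>set l. A \<in> bool_alg X"
    using Cons.prems cA by auto
  let ?m = "Poly_Mapping.single 0 \<mu>" and ?c = "Poly_Mapping.single 0 c :: 'a sgen mon \<Rightarrow>\<^sub>0 'r"
  let ?s = "\<Sum>(c, A)\<leftarrow>l. Poly_Mapping.single 0 c * p A"
  have s: "?s \<in> carrier F" using simple_function_carrier[OF l] .
  have "(?m + ?s + ?c * p A) * p (C \<inter> A) = (?m + ?s) * p (C \<inter> A) + ?c * (p A * p (C \<inter> A))"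
    by (simp add: algebra_simps)
  also have "\<dots> \<approx> (?m + ?s) * p (C \<inter> A) + ?c * p (A \<inter> (C \<inter> A))"
    using U s by (intro eqv_add eqv_mult_left p_mult eqv_refl) auto
  also have "A \<inter> (C \<inter> A) = C \<inter> A" by auto
  also have "(?m + ?s) * p (C \<inter> A) + ?c * p (C \<inter> A) = (Poly_Mapping.single 0 (\<mu> + c) + ?s) * p (C \<inter> A)"
    by (simp add: algebra_simps single_add)
  also have "\<dots> \<approx> 0"
    using Cons.prems U cA by (intro Cons.IH l) (auto simp: add.assoc)
  finally have 1: "(?m + ?s + ?c * p A) * p (C \<inter> A) \<approx> 0" .
  have "(?m + ?s + ?c * p A) * p (C - A) = (?m + ?s) * p (C - A) + ?c * (p A * p (C - A))"
    by (simp add: algebra_simps)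
  also have "\<dots> \<approx> (?m + ?s) * p (C - A) + ?c * p (A \<inter> (C - A))"
    using U s by (intro eqv_add eqv_mult_left p_mult eqv_refl) auto
  also have "A \<inter> (C - A) = {}" by auto
  also have "(?m + ?s) * p (C - A) + ?c * p {} \<approx> 0 + ?c * 0"
    using Cons.prems U cA by (intro eqv_add Cons.IH l eqv_mult_left p_empty) auto
  finally have 2: "(?m + ?s + ?c * p A) * p (C - A) \<approx> 0" by simp
  have "(?m + ?s + ?c * p A) * p C \<approx> (?m + ?s + ?c * p A) * (p (C \<inter> A) + p (C - A))"
    using U s by (intro eqv_mult_left p_split) auto
  also have "\<dots> = (?m + ?s + ?c * p A) * p (C \<inter> A) + (?m + ?s + ?c * p A) * p (C - A)"
    by (rule distrib_left)
  also have "\<dots> \<approx> 0 + 0" by (intro eqv_add 1 2)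
  finally show ?case by (simp add: cA algebra_simps)
qed

lemma act_scalar: "act X (Poly_Mapping.single 0 c * f) \<phi> = (\<lambda>x k. c * act X f \<phi> x k)"
  by (auto simp: act_mult act_single zero_mon_def fun_eq_iff act_outside)

lemma act_canonical:
  assumes "canonical \<alpha> A \<beta>"
  shows "act X (smonom \<alpha> A \<beta>) \<phi> x k = (if \<exists>w\<in>A. x = \<alpha> \<frown> w
     then \<phi> (\<beta> \<frown> suffix (length \<alpha>) x) (k - int (length \<alpha>) + int (length \<beta>)) else 0)"
  using assms unfolding act_smonom canonical_def pull_def prefix_length_eq_iff by auto

text \<open>The operator of a normal list as an explicit formula. The tests for membership in
  \<open>X\<close> have disappeared since canonical sets pass them.\<close>

definition opsum :: "('a, 'r) summand list \<Rightarrow> ('a, 'r) graded_fun \<Rightarrow> ('a, 'r) graded_fun" where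
  "opsum l \<phi> x k = (\<Sum>(c, \<alpha>, A, \<beta>)\<leftarrow>l. if \<exists>w\<in>A. x = \<alpha> \<frown> w
     then c * \<phi> (\<beta> \<frown> suffix (length \<alpha>) x) (k - int (length \<alpha>) + int (length \<beta>)) else 0)"

lemma opsum_simps [simp]:
  "opsum [] \<phi> x k = 0"
  "opsum ((c, \<alpha>, A, \<beta>) # l) \<phi> x k = (if \<exists>w\<in>A. x = \<alpha> \<frown> w
     then c * \<phi> (\<beta> \<frown> suffix (length \<alpha>) x) (k - int (length \<alpha>) + int (length \<beta>)) else 0) + opsum l \<phi> x k"
  by (simp_all add: opsum_def)

lemma act_lsum: "normal l \<Longrightarrow> act X (lsum l) \<phi> x k = opsum l \<phi> x k"
  by (induction l) (auto simp: act_add act_scalar act_canonical simp del: build_append)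

definition delta :: "(nat \<Rightarrow> 'a) \<Rightarrow> int \<Rightarrow> ('a, 'r) graded_fun" where
  "delta y j = (\<lambda>x k. if x = y \<and> k = j then 1 else 0)"

text \<open>By \<open>reduced_unique\<close> no other reduced pair relates the same two points with
  the same change of degree, so this matrix entry sums exactly the coefficients belonging to the
  pair and the tail.\<close>

lemma opsum_germ:
  assumes "normal l" and "reduced \<alpha> \<beta>"
  shows "opsum l (delta (\<beta> \<frown> w) 0) (\<alpha> \<frown> w) (int (length \<alpha>) - int (length \<beta>)) =
    (\<Sum>(c, \<alpha>', A, \<beta>')\<leftarrow>l. if \<alpha>' = \<alpha> \<and> \<beta>' = \<beta> \<and> w \<in> A then c else 0)"
  using assms(1)
proof (induction l)
  case Nil
  show ?case by (simp add: opsum_def)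
next
  case (Cons t l)
  obtain c \<alpha>' A \<beta>' where t: "t = (c, \<alpha>', A, \<beta>')" by (cases t)
  then have red: "reduced \<alpha>' \<beta>'" using Cons.prems by (simp add: canonical_def)
  have "(if \<exists>w'\<in>A. \<alpha> \<frown> w = \<alpha>' \<frown> w' then c * delta (\<beta> \<frown> w) 0 (\<beta>' \<frown> suffix (length \<alpha>') (\<alpha> \<frown> w))
      (int (length \<alpha>) - int (length \<beta>) - int (length \<alpha>') + int (length \<beta>')) else 0)
     = (if \<alpha>' = \<alpha> \<and> \<beta>' = \<beta> \<and> w \<in> A then c else 0)" (is "?l = ?r")
  proof (cases "\<exists>w'\<in>A. \<alpha> \<frown> w = \<alpha>' \<frown> w'")
    case True
    then obtain w' where w': "w' \<in> A" "\<alpha> \<frown> w = \<alpha>' \<frown> w'" by auto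
    then have l: "?l = c * delta (\<beta> \<frown> w) 0 (\<beta>' \<frown> w')
      (int (length \<alpha>) - int (length \<beta>) - int (length \<alpha>') + int (length \<beta>'))" by auto
    show ?thesis
    proof (cases "\<beta>' \<frown> w' = \<beta> \<frown> w \<and>
        int (length \<alpha>) - int (length \<beta>) - int (length \<alpha>') + int (length \<beta>') = 0")
      case True
      then have "\<alpha> = \<alpha>' \<and> \<beta> = \<beta>' \<and> w = w'"
        using w' by (intro reduced_unique[OF assms(2) red]) auto
      then show ?thesis using w'(1) unfolding l by (simp add: delta_def)
    next
      case False
      then have "?l = 0" by (subst l) (auto simp: delta_def)
      moreover have "?r = 0" using False w' by auto
      ultimately show ?thesis by simp
    qed
  next
    case False
    then show ?thesis by auto
  qed
  then show ?case using Cons unfolding t by (simp del: build_append)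
qed

lemma lsum_eq_product:
  assumes "\<forall>(c, \<alpha>', A, \<beta>')\<in>set l. \<alpha>' = \<alpha> \<and> \<beta>' = \<beta>"
  shows "lsum l = sword \<alpha> * (\<Sum>(c, A)\<leftarrow>map (\<lambda>(c, \<alpha>, A, \<beta>). (c, A)) l. Poly_Mapping.single 0 c * p A) * sstarword \<beta>"
  using assms
proof (induction l)
  case (Cons t l)
  obtain c A where t: "t = (c, \<alpha>, A, \<beta>)" using Cons.prems by (cases t) auto
  have "Poly_Mapping.single 0 c * smonom \<alpha> A \<beta> = (Poly_Mapping.single 0 c * sword \<alpha>) * p A * sstarword \<beta>"
    by (simp add: smonom_def mult.assoc)
  also have "\<dots> = sword \<alpha> * (Poly_Mapping.single 0 c * p A) * sstarword \<beta>"
    by (subst single_zero_central) (simp add: mult.assoc)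
  finally show ?case using Cons unfolding t by (simp add: distrib_left distrib_right)
qed simp

text \<open>Collect all summands with the pair of the head. \<open>opsum_germ\<close> shows that
  their coefficient function vanishes pointwise, so \<open>simple_function_eqv_zero\<close> makes
  their sum zero modulo the relations. The remaining shorter list therefore still acts as
  zero.\<close>

lemma lsum_eqv_zero:
  "normal l \<Longrightarrow> (\<And>y x k. opsum l (delta y 0) x k = 0) \<Longrightarrow> lsum l \<approx> 0"
proof (induction "length l" arbitrary: l rule: less_induct)
  case less
  show ?case
  proof (cases l)
    case Nil
    then show ?thesis using eqv_refl[of 0] by simp
  next
    case (Cons t l')
    obtain c \<alpha> A \<beta> where t: "t = (c, \<alpha>, A, \<beta>)" by (cases t)
    have red: "reduced \<alpha> \<beta>" using less.prems Cons t by (simp add: canonical_def)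
    let ?key = "\<lambda>(c, \<alpha>', A, \<beta>'). \<alpha>' = \<alpha> \<and> \<beta>' = \<beta>"
    let ?G = "filter ?key l" and ?H = "filter (\<lambda>t. \<not> ?key t) l"
    have nor: "normal ?G" "normal ?H" using less.prems(1) unfolding normal_def by auto
    have split: "lsum l = lsum ?G + lsum ?H"
    proof (induction l)
      case (Cons t l)
      obtain c \<alpha> A \<beta> where "t = (c, \<alpha>, A, \<beta>)" by (cases t)
      then show ?case using Cons by (simp add: algebra_simps)
    qed simp
    let ?L = "map (\<lambda>(c, \<alpha>, A, \<beta>). (c, A)) ?G"
    let ?s = "\<Sum>(c, A)\<leftarrow>?L. Poly_Mapping.single 0 c * p A"
    have L: "\<forall>(c, A)\<in>set ?L. A \<in> bool_alg X"
      using nor(1) unfolding normal_def canonical_def by auto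
    have s: "?s \<in> carrier F" using simple_function_carrier[OF L] .
    have "(\<Sum>(c, A)\<leftarrow>?L. if w \<in> A then c else 0) = 0" for w
    proof -
      have "(\<Sum>(c, A)\<leftarrow>?L. if w \<in> A then c else 0) =
          (\<Sum>(c, \<alpha>', A, \<beta>')\<leftarrow>l. if \<alpha>' = \<alpha> \<and> \<beta>' = \<beta> \<and> w \<in> A then c else 0)"
        by (induction l) (auto split: if_splits)
      also have "\<dots> = 0" using opsum_germ[OF less.prems(1) red] less.prems(2) by metis
      finally show ?thesis .
    qed
    \<comment> \<open>The splitting starts with accumulated coefficient zero on all of
      \<open>X\<close>; the factor \<open>p X\<close> is the unit and is dropped afterwards.\<close>
    then have "(Poly_Mapping.single 0 0 + ?s) * p X \<approx> 0"
      by (intro simple_function_eqv_zero L) auto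
    then have "?s * p X \<approx> 0" by simp
    moreover have "?s \<approx> ?s * p X" using eqv_mult_left[OF eqv_sym[OF p_X] s] by simp
    ultimately have "?s \<approx> 0" using eqv_trans by blast
    then have "sword \<alpha> * ?s * sstarword \<beta> \<approx> sword \<alpha> * 0 * sstarword \<beta>"
      by (intro eqv_mult_right eqv_mult_left) auto
    then have G: "lsum ?G \<approx> 0"
      by (subst lsum_eq_product[of ?G \<alpha> \<beta>]) auto
    have "opsum ?H (delta y 0) x k = 0" for y x k
    proof -
      have "opsum ?H (delta y 0) x k = act X (lsum l) (delta y 0) x k - act X (lsum ?G) (delta y 0) x k"
        unfolding split using nor by (simp add: act_add act_lsum)
      also have "\<dots> = 0" using act_eqv[OF G] less.prems by (simp add: act_lsum)
      finally show ?thesis .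
    qed
    moreover have "length ?H < length l"
      using Cons t by (auto simp: less_Suc_eq_le intro: length_filter_le)
    ultimately have "lsum ?H \<approx> 0" using less.hyps nor by blast
    then show ?thesis unfolding split using eqv_add[OF G] by fastforce
  qed
qed

lemma act_faithful:
  assumes "f \<in> carrier F" and "\<And>y x k. act X f (delta y 0) x k = 0"
  shows "f \<in> I"
proof -
  obtain l where l: "normal l" "f \<approx> lsum l" using eqv_lsum[OF assms(1)] by blast
  have "opsum l (delta y 0) x k = 0" for y x k
    using act_lsum[OF l(1)] act_eqv[OF l(2)] assms(2) by metis
  then have "f \<approx> 0" using lsum_eqv_zero[OF l(1)] eqv_trans[OF l(2)] by blast
  then show ?thesis by (simp add: eqv_def)
qed

end


section \<open>The faithful representation of the subshift algebra\<close>

lemma letters_zero: "letters 0 = []"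
  by (simp add: zero_mon_def)

lemma lookup_single_mult:
  fixes h :: "int \<Rightarrow>\<^sub>0 'r::comm_ring_1"
  shows "Poly_Mapping.lookup (Poly_Mapping.single n c * h) k = c * Poly_Mapping.lookup h (k - n)"
proof (induction h rule: poly_mapping_additive_induct)
  case (single m d)
  show ?case by (auto simp: mult_single lookup_single when_def)
qed (simp_all add: distrib_left lookup_add)

text \<open>An inverse \<open>G\<close> would have equal coefficients at \<open>k\<close> and
  \<open>k - n\<close> except for a jump at \<open>k = 0\<close>. At the least exponent of
  \<open>G\<close> there is a jump, so that exponent is \<open>0\<close>; \<open>n\<close> past the
  greatest exponent there is another, so the greatest exponent is \<open>- n\<close>, below the
  least.\<close>

lemma one_minus_single_not_unit:
  fixes G :: "int \<Rightarrow>\<^sub>0 'r::comm_ring_1"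
  assumes n: "n > 0"
  shows "G * (1 - Poly_Mapping.single n 1) \<noteq> 1"
proof
  assume "G * (1 - Poly_Mapping.single n 1) = 1"
  then have "G - Poly_Mapping.single n 1 * G = 1" by (simp add: right_diff_distrib mult.commute)
  then have "Poly_Mapping.lookup (G - Poly_Mapping.single n 1 * G) k = (1 when k = 0)" for k
    by (simp add: lookup_one)
  then have "Poly_Mapping.lookup G k - Poly_Mapping.lookup G (k - n) = (1 when k = 0)" for k
    by (simp add: lookup_minus lookup_single_mult)
  then have rec: "Poly_Mapping.lookup G k = Poly_Mapping.lookup G (k - n) + (1 when k = 0)" for k
    by (metis add.commute diff_add_cancel)
  let ?K = "Poly_Mapping.keys G"
  have ne: "?K \<noteq> {}"
  proof
    assume "?K = {}"
    then have "\<And>k. Poly_Mapping.lookup G k = 0" by (auto simp: in_keys_iff)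
    then show False using rec[of 0] by simp
  qed
  have min: "Poly_Mapping.lookup G (Min ?K - n) = 0"
  proof (rule ccontr)
    assume "Poly_Mapping.lookup G (Min ?K - n) \<noteq> 0"
    then have "Min ?K \<le> Min ?K - n" by (intro Min_le finite_keys) (simp add: in_keys_iff)
    then show False using n by simp
  qed
  have "Poly_Mapping.lookup G (Min ?K) \<noteq> 0" using Min_in[OF finite_keys ne] by (simp add: in_keys_iff)
  then have "Min ?K = 0" using rec[of "Min ?K"] min by (auto simp: when_def split: if_splits)
  have max: "Poly_Mapping.lookup G (Max ?K + n) = 0"
  proof (rule ccontr)
    assume "Poly_Mapping.lookup G (Max ?K + n) \<noteq> 0"
    then have "Max ?K + n \<le> Max ?K" by (intro Max_ge finite_keys) (simp add: in_keys_iff)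
    then show False using n by simp
  qed
  have "Poly_Mapping.lookup G (Max ?K) \<noteq> 0" using Max_in[OF finite_keys ne] by (simp add: in_keys_iff)
  then have "Max ?K + n = 0" using rec[of "Max ?K + n"] max by (auto simp: when_def split: if_splits)
  moreover have "Min ?K \<le> Max ?K" using Min_le[OF finite_keys] Max_in[OF finite_keys ne] by blast
  ultimately show False using \<open>Min ?K = 0\<close> n by simp
qed

lemma common_tail_periodic:
  assumes "\<alpha> \<noteq> \<beta>" and "\<alpha> \<frown> w = \<beta> \<frown> w"
  obtains \<gamma> where "\<gamma> \<noteq> []" "w = \<gamma>\<^sup>\<omega>" "w = \<gamma> \<frown> w" "\<beta> = \<alpha> @ \<gamma> \<or> \<alpha> = \<beta> @ \<gamma>"
proof -
  note goal = that
  have *: thesis if ne: "\<alpha>' \<noteq> \<beta>'" and eq: "\<alpha>' \<frown> w = \<beta>' \<frown> w" and le: "length \<alpha>' \<le> length \<beta>'"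
    and sub: "{\<alpha>', \<beta>'} = {\<alpha>, \<beta>}" for \<alpha>' \<beta>'
  proof -
    obtain \<gamma> where g: "\<beta>' = \<alpha>' @ \<gamma>" "w = \<gamma> \<frown> w" using conc_overlap[OF eq le] .
    then have "\<gamma> \<noteq> []" using ne by auto
    then show thesis using goal[of \<gamma>] conc_fixpoint_eq_iter[OF g(2)] g sub by (auto simp: doubleton_eq_iff)
  qed
  show thesis
  proof (cases "length \<alpha> \<le> length \<beta>")
    case True
    then show thesis using *[of \<alpha> \<beta>] assms by simp
  next
    case False
    then show thesis using *[of \<beta> \<alpha>] assms by (simp add: insert_commute)
  qed
qed

text \<open>The period \<open>\<gamma>\<close> is the overhang of the longer word, hence read off
  from \<open>\<alpha>\<close> and \<open>\<beta>\<close> alone, and it determines the tail. So a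
  pair of distinct words fixes at most one point.\<close>

lemma common_tail_unique:
  assumes "\<alpha> \<noteq> \<beta>" and "\<alpha> \<frown> w = \<beta> \<frown> w" and "\<alpha> \<frown> w' = \<beta> \<frown> w'"
  shows "w = w'"
proof -
  obtain \<gamma> where g: "w = \<gamma>\<^sup>\<omega>" "\<beta> = \<alpha> @ \<gamma> \<or> \<alpha> = \<beta> @ \<gamma>"
    using common_tail_periodic[OF assms(1,2)] by metis
  obtain \<gamma>' where g': "w' = \<gamma>'\<^sup>\<omega>" "\<beta> = \<alpha> @ \<gamma>' \<or> \<alpha> = \<beta> @ \<gamma>'"
    using common_tail_periodic[OF assms(1,3)] by metis
  have "\<gamma> = \<gamma>'" using g g' assms(1) by auto
  then show ?thesis using g g' by simp
qed

text \<open>If replacing \<open>\<beta>\<close> by \<open>\<alpha>\<close> does not fix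
  \<open>z\<close>, it takes no point of a small cylinder around \<open>z\<close> back into that
  cylinder. Either \<open>z\<close> fails to begin with one of the words, or its tails behind them
  differ at some place.\<close>

lemma cylinder_separates:
  assumes "\<nexists>w. z = \<alpha> \<frown> w \<and> z = \<beta> \<frown> w"
  shows "\<exists>N. \<forall>n\<ge>N. \<forall>w. \<not> (prefix n (\<alpha> \<frown> w) = prefix n z \<and> prefix n (\<beta> \<frown> w) = prefix n z)"
proof -
  have agree: "x i = z i" if "prefix n x = prefix n z" "i < n" for x i n
    using that by (metis add.left_neutral diff_zero subsequence_nth)
  have pre: "\<exists>u. z = \<gamma> \<frown> u" if "prefix n (\<gamma> \<frown> w) = prefix n z" "length \<gamma> \<le> n" for \<gamma> w n
  proof -
    have "prefix (length \<gamma>) z = take (length \<gamma>) (prefix n z)" using that by (simp add: min_def)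
    also have "\<dots> = prefix (length \<gamma>) (\<gamma> \<frown> w)" unfolding that(1)[symmetric] using that(2) by (simp add: min_def)
    finally show ?thesis by (simp add: prefix_length_eq_iff)
  qed
  show ?thesis
  proof (cases "\<exists>u v. z = \<alpha> \<frown> u \<and> z = \<beta> \<frown> v")
    case False
    show ?thesis
      by (rule exI[of _ "max (length \<alpha>) (length \<beta>)"]) (use False pre in fastforce)
  next
    case True
    then obtain u v where uv: "z = \<alpha> \<frown> u" "z = \<beta> \<frown> v" by blast
    then have "u \<noteq> v" using assms by auto
    then obtain j where j: "u j \<noteq> v j" by auto
    show ?thesis
    \<comment> \<open>The cylinder must show position \<open>j\<close> of the tail behind either
      word, hence one letter more than the longer word plus \<open>j\<close>.\<close>
    proof (intro exI[of _ "max (length \<alpha>) (length \<beta>) + j + 1"] allI impI notI)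
      fix n w assume n: "max (length \<alpha>) (length \<beta>) + j + 1 \<le> n"
        and w: "prefix n (\<alpha> \<frown> w) = prefix n z \<and> prefix n (\<beta> \<frown> w) = prefix n z"
      have "(\<alpha> \<frown> w) (length \<alpha> + j) = z (length \<alpha> + j)" "(\<beta> \<frown> w) (length \<beta> + j) = z (length \<beta> + j)"
        using agree[of "\<alpha> \<frown> w" n "length \<alpha> + j"] agree[of "\<beta> \<frown> w" n "length \<beta> + j"] n w by linarith+
      moreover have "z (length \<alpha> + j) = u j" using uv(1) by simp
      moreover have "z (length \<beta> + j) = v j" using uv(2) by simp
      ultimately show False using j by simp
    qed
  qed
qed

lemma tail_equiv_refl: "tail_equiv x x"
  unfolding tail_equiv_def by blast

lemma tail_equiv_sym: "tail_equiv x y \<Longrightarrow> tail_equiv y x"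
  unfolding tail_equiv_def by metis

lemma tail_equiv_trans: "tail_equiv x y \<Longrightarrow> tail_equiv y z \<Longrightarrow> tail_equiv x z"
proof -
  assume "tail_equiv x y" "tail_equiv y z"
  then obtain m n m' n' where "suffix m x = suffix n y" "suffix m' y = suffix n' z"
    unfolding tail_equiv_def by auto
  then have "suffix (m + m') x = suffix (n' + n) z"
    by (metis add.commute suffix_suffix)
  then show ?thesis unfolding tail_equiv_def by blast
qed

lemma tail_equiv_conc: "tail_equiv (\<alpha> \<frown> w) (\<beta> \<frown> w)"
  unfolding tail_equiv_def by (metis suffix_conc_length)

section \<open>Passing to the quotient algebra\<close>

context letter_subshift_algebra
begin

sublocale B: ring B
  unfolding subshift_algebra_def by (rule I.quotient_is_ring)

definition cls :: "('a sgen mon \<Rightarrow>\<^sub>0 'r) \<Rightarrow> ('a sgen mon \<Rightarrow>\<^sub>0 'r) set" where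
  "cls f = I +>\<^bsub>F\<^esub> f"

text \<open>The choice of representative is immaterial because \<open>act\<close> is constant on
  cosets.\<close>

definition \<rho> :: "('a sgen mon \<Rightarrow>\<^sub>0 'r) set \<Rightarrow> ('a, 'r) graded_fun \<Rightarrow> ('a, 'r) graded_fun" where
  "\<rho> b = act X (SOME f. f \<in> carrier F \<and> cls f = b)"

lemma carrier_B: "carrier B = cls ` carrier F"
  by (auto simp: subshift_algebra_def FactRing_def A_RCOSETS_def' cls_def)

lemma cls_in_carrier [simp, intro]: "f \<in> carrier F \<Longrightarrow> cls f \<in> carrier B"
  by (simp add: carrier_B)

lemma cls_eq_iff: "f \<in> carrier F \<Longrightarrow> g \<in> carrier F \<Longrightarrow> cls f = cls g \<longleftrightarrow> f - g \<in> I"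
  using F.quotient_eq_iff_same_a_r_cos[OF I.ideal_axioms, of f g] by (simp add: F_minus cls_def)

lemma \<rho>_cls: assumes "f \<in> carrier F" shows "\<rho> (cls f) = act X f"
proof -
  let ?g = "SOME g. g \<in> carrier F \<and> cls g = cls f"
  have "?g \<in> carrier F \<and> cls ?g = cls f" using someI[of "\<lambda>g. g \<in> carrier F \<and> cls g = cls f" f] assms by simp
  then have "?g \<approx> f" using assms cls_eq_iff[of ?g f] by (simp add: eqv_def)
  then show ?thesis unfolding \<rho>_def by (rule act_eqv)
qed

lemma cls_hom: "ring_hom_ring F B cls"
  unfolding cls_def subshift_algebra_def by (rule I.rcos_ring_hom_ring)

lemma cls_ops:
  "f \<in> carrier F \<Longrightarrow> g \<in> carrier F \<Longrightarrow> cls (f * g) = cls f \<otimes>\<^bsub>B\<^esub> cls g"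
  "f \<in> carrier F \<Longrightarrow> g \<in> carrier F \<Longrightarrow> cls (f + g) = cls f \<oplus>\<^bsub>B\<^esub> cls g"
  "cls 0 = \<zero>\<^bsub>B\<^esub>"
  using ring_hom_ring.homh[OF cls_hom] ring_hom_mult ring_hom_add ring_hom_zero
    F.ring_axioms B.ring_axioms by fastforce+

lemma \<rho>_mult:
  assumes "a \<in> carrier B" "b \<in> carrier B"
  shows "\<rho> (a \<otimes>\<^bsub>B\<^esub> b) \<phi> = \<rho> a (\<rho> b \<phi>)"
proof -
  obtain f g where fg: "f \<in> carrier F" "g \<in> carrier F" "a = cls f" "b = cls g"
    using assms by (auto simp: carrier_B)
  then show ?thesis using \<rho>_cls[of "f * g"] by (simp add: cls_ops \<rho>_cls act_mult)
qed

lemma \<rho>_add: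
  assumes "a \<in> carrier B" "b \<in> carrier B"
  shows "\<rho> (a \<oplus>\<^bsub>B\<^esub> b) \<phi> = (\<lambda>x k. \<rho> a \<phi> x k + \<rho> b \<phi> x k)"
proof -
  obtain f g where fg: "f \<in> carrier F" "g \<in> carrier F" "a = cls f" "b = cls g"
    using assms by (auto simp: carrier_B)
  then show ?thesis using \<rho>_cls[of "f + g"] by (simp add: cls_ops \<rho>_cls act_add)
qed

lemma \<rho>_zero: "\<rho> \<zero>\<^bsub>B\<^esub> \<phi> = (\<lambda>x k. 0)"
  using \<rho>_cls[of 0] by (simp add: cls_ops)

lemma \<rho>_eq_zero:
  assumes "b \<in> carrier B" and "\<And>y x k. \<rho> b (delta y 0) x k = 0"
  shows "b = \<zero>\<^bsub>B\<^esub>"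
proof -
  obtain f where f: "f \<in> carrier F" "b = cls f" using assms(1) by (auto simp: carrier_B)
  then have "f \<in> I" using assms(2) by (intro act_faithful) (auto simp: \<rho>_cls)
  then show ?thesis using f cls_eq_iff[of f 0] by (simp add: cls_ops)
qed

lemma \<rho>_inj:
  assumes "a \<in> carrier B" "b \<in> carrier B" and "\<And>\<phi> x k. \<rho> a \<phi> x k = \<rho> b \<phi> x k"
  shows "a = b"
proof -
  obtain f g where fg: "f \<in> carrier F" "g \<in> carrier F" "a = cls f" "b = cls g"
    using assms(1,2) by (auto simp: carrier_B)
  then have "f - g \<in> I" using assms(3) by (intro act_faithful) (auto simp: \<rho>_cls act_diff)
  then show ?thesis using fg by (simp add: cls_eq_iff)
qed

lemma \<rho>_opsum:
  assumes "b \<in> carrier B"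
  obtains l where "normal l" and "\<And>\<phi> x k. \<rho> b \<phi> x k = opsum l \<phi> x k"
proof -
  obtain f where f: "f \<in> carrier F" "b = cls f" using assms by (auto simp: carrier_B)
  obtain l where l: "normal l" "f \<approx> lsum l" using eqv_lsum[OF f(1)] by blast
  have "\<rho> b \<phi> x k = opsum l \<phi> x k" for \<phi> x k
    using f act_eqv[OF l(2)] act_lsum[OF l(1)] by (metis \<rho>_cls)
  then show thesis using that l by blast
qed

text \<open>Every generator changes the degree by a constant, so the operators commute with
  translations. Testing on point masses of degree zero thus loses nothing.\<close>

lemma \<rho>_shift:
  assumes "b \<in> carrier B"
  shows "\<rho> b (\<lambda>x k. \<phi> x (k + j)) x k = \<rho> b \<phi> x (k + j)"
proof -
  obtain l where l: "\<And>\<phi> x k. \<rho> b \<phi> x k = opsum l \<phi> x k" using \<rho>_opsum[OF assms] by metis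
  have "opsum l (\<lambda>x k. \<phi> x (k + j)) x k = opsum l \<phi> x (k + j)"
    by (induction l) (auto simp: opsum_def algebra_simps intro: arg_cong2[where f = "(+)"])
  then show ?thesis by (simp add: l)
qed

text \<open>Turns a nonzero matrix entry into two words with a common tail, from which
  \<open>move\<close> elements can be formed that bring the entry elsewhere.\<close>

lemma \<rho>_delta_nonzero:
  assumes "b \<in> carrier B" and "\<rho> b (delta y 0) x k \<noteq> 0"
  obtains \<alpha> \<beta> w where "x = \<alpha> \<frown> w" "y = \<beta> \<frown> w" "k = int (length \<alpha>) - int (length \<beta>)" "x \<in> X" "y \<in> X"
proof -
  obtain l where l: "normal l" "\<And>\<phi> x k. \<rho> b \<phi> x k = opsum l \<phi> x k" using \<rho>_opsum[OF assms(1)] by metis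
  have "\<exists>\<alpha> \<beta> w. x = \<alpha> \<frown> w \<and> y = \<beta> \<frown> w \<and> k = int (length \<alpha>) - int (length \<beta>) \<and> x \<in> X \<and> y \<in> X"
    if "normal l" "opsum l (delta y 0) x k \<noteq> 0"
    using that
  proof (induction l)
    case (Cons t l)
    obtain c \<alpha> A \<beta> where t: "t = (c, \<alpha>, A, \<beta>)" by (cases t)
    show ?case
    proof (cases "opsum l (delta y 0) x k = 0")
      case True
      then obtain w where w: "w \<in> A" "x = \<alpha> \<frown> w"
        and d: "delta y 0 (\<beta> \<frown> suffix (length \<alpha>) x) (k - int (length \<alpha>) + int (length \<beta>)) \<noteq> 0"
        using Cons.prems unfolding t by (auto simp del: build_append split: if_splits)
      then have "y = \<beta> \<frown> w" "k - int (length \<alpha>) + int (length \<beta>) = 0"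
        by (auto simp: delta_def split: if_splits)
      moreover have "x \<in> X" "\<beta> \<frown> w \<in> X" using Cons.prems w unfolding t by (auto simp: canonical_def pull_def)
      ultimately show ?thesis using w by (intro exI[of _ \<alpha>] exI[of _ \<beta>] exI[of _ w]) auto
    next
      case False
      then show ?thesis using Cons unfolding t by simp
    qed
  qed simp
  then show thesis using that l assms(2) by metis
qed

text \<open>Each summand reads its argument at a point obtained from \<open>x\<close> by exchanging
  a prefix, so tail classes do not interact.\<close>

lemma \<rho>_tail_local:
  assumes "b \<in> carrier B" and "\<And>y k. tail_equiv x y \<Longrightarrow> \<phi> y k = 0"
  shows "\<rho> b \<phi> x k = 0"
proof -
  obtain l where l: "\<And>\<phi> x k. \<rho> b \<phi> x k = opsum l \<phi> x k" using \<rho>_opsum[OF assms(1)] by metis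
  have "opsum l \<phi> x k = 0"
  proof (induction l)
    case (Cons t l)
    obtain c \<alpha> A \<beta> where t: "t = (c, \<alpha>, A, \<beta>)" by (cases t)
    have "\<phi> (\<beta> \<frown> suffix (length \<alpha>) x) j = 0" if "x = \<alpha> \<frown> w" for w j
      using assms(2) tail_equiv_conc[of \<alpha> w \<beta>] that by simp
    then show ?case using Cons unfolding t by (auto simp del: build_append)
  qed simp
  then show ?thesis by (simp add: l)
qed

lemma \<rho>_zero_arg: "b \<in> carrier B \<Longrightarrow> \<rho> b (\<lambda>x k. 0) = (\<lambda>x k. 0)"
  by (intro ext \<rho>_tail_local) auto

section \<open>Words, scalars and projections at aperiodic points\<close>

lemma proj_eq_cls: "proj R X A = cls (p A)"
  by (simp add: proj_def cls_def)

lemma proj_in_carrier [simp, intro]: "A \<in> bool_alg X \<Longrightarrow> proj R X A \<in> carrier B"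
  by (auto simp: proj_eq_cls)

lemma \<rho>_proj: "A \<in> bool_alg X \<Longrightarrow> \<rho> (proj R X A) \<phi> = (\<lambda>x k. if x \<in> A then \<phi> x k else 0)"
  using bool_alg_subset by (fastforce simp: proj_eq_cls \<rho>_cls act_var fun_eq_iff)

text \<open>The element that carries a point mass at \<open>\<beta> \<frown> w\<close> to
  \<open>\<alpha> \<frown> w\<close> whenever both points lie in \<open>X\<close>.\<close>

definition move :: "'a list \<Rightarrow> 'a list \<Rightarrow> ('a sgen mon \<Rightarrow>\<^sub>0 'r) set" where
  "move \<alpha> \<beta> = cls (sword \<alpha> * sstarword \<beta>)"

lemma move_in_carrier [simp, intro]: "move \<alpha> \<beta> \<in> carrier B"
  by (auto simp: move_def)

lemma \<rho>_move:
  "\<rho> (move \<alpha> \<beta>) \<phi> = (\<lambda>x k. if x \<in> X \<and> prefix (length \<alpha>) x = \<alpha> \<and> \<beta> \<frown> suffix (length \<alpha>) x \<in> X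
     then \<phi> (\<beta> \<frown> suffix (length \<alpha>) x) (k - int (length \<alpha>) + int (length \<beta>)) else 0)"
  using suffix_closed by (auto simp: move_def \<rho>_cls act_mult act_sword act_sstarword fun_eq_iff)

lemma \<rho>_move_conc:
  "\<alpha> \<frown> w \<in> X \<Longrightarrow> \<beta> \<frown> w \<in> X \<Longrightarrow>
    \<rho> (move \<alpha> \<beta>) \<phi> (\<alpha> \<frown> w) k = \<phi> (\<beta> \<frown> w) (k - int (length \<alpha>) + int (length \<beta>))"
  by (simp add: \<rho>_move)

definition scalar :: "'r \<Rightarrow> ('a sgen mon \<Rightarrow>\<^sub>0 'r) set" where
  "scalar c = cls (Poly_Mapping.single 0 c)"

lemma scalar_in_carrier [simp, intro]: "scalar c \<in> carrier B"
  by (auto simp: scalar_def)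

lemma \<rho>_scalar: "\<rho> (scalar c) \<phi> = (\<lambda>x k. if x \<in> X then c * \<phi> x k else 0)"
  by (auto simp: scalar_def \<rho>_cls act_single fun_eq_iff letters_zero)

lemma point_in_X: "{q} \<in> bool_alg X \<Longrightarrow> q \<in> X"
  using bool_alg_subset by auto

text \<open>Conjugating the projection of \<open>q\<close> by the \<open>move\<close> elements
  between the two prefixes of the common tail gives the projection of \<open>q'\<close>.
  Faithfulness reduces this identity to a comparison of operators.\<close>

lemma point_ideal_mono:
  assumes q: "{q} \<in> bool_alg X" and q': "{q'} \<in> bool_alg X" and "tail_equiv q q'"
  shows "point_ideal R X q' \<subseteq> point_ideal R X q"
proof -
  obtain m n where mn: "suffix m q = suffix n q'" using assms(3) unfolding tail_equiv_def by auto
  define \<alpha> \<beta> w where "\<alpha> = prefix m q" and "\<beta> = prefix n q'" and "w = suffix m q"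
  have eq: "q = \<alpha> \<frown> w" "q' = \<beta> \<frown> w"
    unfolding \<alpha>_def \<beta>_def w_def using mn by (metis prefix_suffix)+
  note qX = point_in_X[OF q] point_in_X[OF q']
  let ?e = "move \<beta> \<alpha> \<otimes>\<^bsub>B\<^esub> proj R X {q} \<otimes>\<^bsub>B\<^esub> move \<alpha> \<beta>"
  have "proj R X {q'} = ?e"
  proof (rule \<rho>_inj)
    fix \<phi> x k
    have "x = q' \<longleftrightarrow> prefix (length \<beta>) x = \<beta> \<and> suffix (length \<beta>) x = w"
      unfolding eq by (metis prefix_conc_length prefix_suffix suffix_conc_length)
    then show "\<rho> (proj R X {q'}) \<phi> x k = \<rho> ?e \<phi> x k"
      using q q' qX unfolding eq by (auto simp: \<rho>_mult \<rho>_proj \<rho>_move)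
  qed (use q q' in auto)
  moreover interpret J: ideal "point_ideal R X q" B
    unfolding point_ideal_def using q by (intro B.genideal_ideal) auto
  have "proj R X {q} \<in> point_ideal R X q"
    unfolding point_ideal_def using q by (intro B.genideal_self') auto
  then have "?e \<in> point_ideal R X q" by (intro J.I_l_closed J.I_r_closed) auto
  ultimately have "proj R X {q'} \<in> point_ideal R X q" by simp
  then show ?thesis
    unfolding point_ideal_def[of R X q'] by (intro B.genideal_minimal J.ideal_axioms) auto
qed

text \<open>Two different prefixes with the same tail would make the tail periodic. Its period and
  the prefix are blocks of points of \<open>X\<close>, hence words of the language, as the
  definition of \<open>QX\<close> demands.\<close>

lemma QX_aperiodic:
  assumes q: "q \<in> QX X" and "q = \<alpha> \<frown> w" and "q = \<beta> \<frown> w"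
  shows "\<alpha> = \<beta>"
proof (rule ccontr)
  assume "\<alpha> \<noteq> \<beta>"
  then obtain \<gamma> where g: "\<gamma> \<noteq> []" "w = \<gamma>\<^sup>\<omega>" "w = \<gamma> \<frown> w" using common_tail_periodic assms by metis
  have qX: "q \<in> X" using q point_in_X unfolding QX_def by auto
  then have "w \<in> X" using conc_tail assms(2) by metis
  then have "\<gamma> \<in> language X" using g(3) prefix_in_language by metis
  moreover have "\<alpha> \<in> language X" using qX prefix_in_language assms(2) by metis
  ultimately show False using q g assms(2) unfolding QX_def by auto
qed

text \<open>A summand that returns from \<open>q\<close> to \<open>q\<close> must have equal words
  by aperiodicity, so it preserves the degree and contributes its coefficient only.\<close>

lemma QX_corner:
  assumes q: "q \<in> QX X" and b: "b \<in> carrier B"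
  obtains c where "\<And>\<phi> k. \<rho> b (\<lambda>x k. if x = q then \<phi> x k else 0) q k = c * \<phi> q k"
proof -
  obtain l where l: "\<And>\<phi> x k. \<rho> b \<phi> x k = opsum l \<phi> x k" using \<rho>_opsum[OF b] by metis
  have "\<exists>c. \<forall>\<phi> k. opsum l (\<lambda>x k. if x = q then \<phi> x k else 0) q k = c * \<phi> q k"
  proof (induction l)
    case Nil
    show ?case by (intro exI[of _ 0]) (simp add: opsum_def)
  next
    case (Cons t l)
    then obtain d where d: "\<And>\<phi> k. opsum l (\<lambda>x k. if x = q then \<phi> x k else 0) q k = d * \<phi> q k" by auto
    obtain c \<alpha> A \<beta> where t: "t = (c, \<alpha>, A, \<beta>)" by (cases t)
    show ?case
    proof (cases "\<exists>w\<in>A. q = \<alpha> \<frown> w \<and> q = \<beta> \<frown> w")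
      case True
      then obtain w where w: "w \<in> A" "q = \<alpha> \<frown> w" "q = \<beta> \<frown> w" by auto
      then have "\<alpha> = \<beta>" using QX_aperiodic[OF q] by blast
      then have "opsum (t # l) (\<lambda>x k. if x = q then \<phi> x k else 0) q k = (c + d) * \<phi> q k" for \<phi> k
        using w d unfolding t by (auto simp: distrib_right simp del: build_append)
      then show ?thesis by blast
    next
      case False
      then have "opsum (t # l) (\<lambda>x k. if x = q then \<phi> x k else 0) q k = d * \<phi> q k" for \<phi> k
        using d unfolding t by (auto simp del: build_append)
      then show ?thesis by blast
    qed
  qed
  then show thesis using that l by metis
qed

text \<open>If \<open>d\<close> does not kill the projection, it sends the point mass at
  \<open>q\<close> to something nonzero at a tail-equivalent point \<open>x\<close>. Moving that
  value back to \<open>q\<close> and cutting down to \<open>q\<close> leaves a nonzero scalar by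
  \<open>QX_corner\<close>, and division by it recovers the projection.\<close>

lemma left_simple_proj_QX:
  assumes q: "q \<in> QX X"
  shows "B.left_simple (proj R X {q})"
  unfolding B.left_simple_def
proof (intro conjI ballI impI)
  have qU: "{q} \<in> bool_alg X" using q unfolding QX_def by auto
  then show P: "proj R X {q} \<in> carrier B" by auto
  note qX = point_in_X[OF qU]
  fix d assume d: "d \<in> carrier B" and nz: "d \<otimes>\<^bsub>B\<^esub> proj R X {q} \<noteq> \<zero>\<^bsub>B\<^esub>"
  obtain y x k where nz: "\<rho> (d \<otimes>\<^bsub>B\<^esub> proj R X {q}) (delta y 0) x k \<noteq> 0"
    using \<rho>_eq_zero[of "d \<otimes>\<^bsub>B\<^esub> proj R X {q}"] nz d P by blast
  then have nz: "\<rho> d (\<lambda>x k. if x = q then delta y 0 x k else 0) x k \<noteq> 0"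
    using d P qU by (simp add: \<rho>_mult \<rho>_proj)
  \<comment> \<open>The projection at \<open>q\<close> annihilates the point mass of every other
    point.\<close>
  have "y = q"
  proof (rule ccontr)
    assume "y \<noteq> q"
    then have "(\<lambda>x k. if x = q then delta y 0 x k else 0) = (\<lambda>x k. 0)"
      using \<open>y \<noteq> q\<close> by (intro ext) (simp add: delta_def)
    then show False using nz \<rho>_zero_arg[OF d] by metis
  qed
  have restr: "(\<lambda>x k. if x = q then delta q 0 x k else 0) = delta q 0"
    by (auto simp: delta_def fun_eq_iff)
  have nz: "\<rho> d (delta q 0) x k \<noteq> 0" using nz unfolding \<open>y = q\<close> restr .
  then obtain \<alpha> \<beta> w where w: "x = \<alpha> \<frown> w" "q = \<beta> \<frown> w" "k = int (length \<alpha>) - int (length \<beta>)" "x \<in> X"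
    using \<rho>_delta_nonzero[OF d] by metis
  let ?b = "move \<beta> \<alpha> \<otimes>\<^bsub>B\<^esub> d"
  obtain c where c: "\<And>\<phi> k. \<rho> ?b (\<lambda>x k. if x = q then \<phi> x k else 0) q k = c * \<phi> q k"
    using QX_corner[OF q, of ?b] d by auto
  have "\<rho> ?b (delta q 0) q 0 = \<rho> d (delta q 0) x k"
    using w qX d by (simp add: \<rho>_mult \<rho>_move_conc del: build_append)
  moreover have "\<rho> ?b (delta q 0) q 0 = c"
    using c[of "delta q 0" 0] unfolding restr by (simp add: delta_def)
  ultimately have "c \<noteq> 0" using nz by simp
  let ?e = "scalar (inverse c) \<otimes>\<^bsub>B\<^esub> (proj R X {q} \<otimes>\<^bsub>B\<^esub> move \<beta> \<alpha>)"
  have "?e \<otimes>\<^bsub>B\<^esub> (d \<otimes>\<^bsub>B\<^esub> proj R X {q}) = proj R X {q}"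
  proof (rule \<rho>_inj)
    fix \<phi> x k
    show "\<rho> (?e \<otimes>\<^bsub>B\<^esub> (d \<otimes>\<^bsub>B\<^esub> proj R X {q})) \<phi> x k = \<rho> (proj R X {q}) \<phi> x k"
      using c[of \<phi> k] d P qU qX \<open>c \<noteq> 0\<close> by (auto simp: \<rho>_mult \<rho>_proj \<rho>_scalar)
  qed (use d P in auto)
  moreover have "?e \<in> carrier B" using P by auto
  ultimately show "\<exists>e\<in>carrier B. e \<otimes>\<^bsub>B\<^esub> (d \<otimes>\<^bsub>B\<^esub> proj R X {q}) = proj R X {q}" by blast
qed

end


section \<open>Reduction to isolated points\<close>

context letter_subshift_algebra
begin

lemma normalD: "normal l \<Longrightarrow> (c, \<alpha>, A, \<beta>) \<in> set l \<Longrightarrow> canonical \<alpha> A \<beta>"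
  unfolding normal_def by blast

lemma prefix_eq_in_bool_alg: "{y \<in> X. prefix n y = prefix n x} \<in> bool_alg X"
  using cyl_in_bool_alg[of "[]" "prefix n x"] by (simp add: prefix_cyl)

lemma prefix_separates: "x \<noteq> y \<Longrightarrow> \<exists>n. prefix n x \<noteq> prefix n y"
proof -
  assume "x \<noteq> y"
  then obtain i where "x i \<noteq> y i" by auto
  then have "prefix (Suc i) x \<noteq> prefix (Suc i) y" by simp
  then show ?thesis by blast
qed

text \<open>As long as another point is left, intersect with a prefix cylinder around
  \<open>w\<close> that excludes it; the finite set strictly shrinks.\<close>

lemma point_of_finite_in_bool_alg:
  "finite A \<Longrightarrow> A \<in> bool_alg X \<Longrightarrow> w \<in> A \<Longrightarrow> {w} \<in> bool_alg X"
proof (induction A rule: finite_psubset_induct)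
  case (psubset A)
  show ?case
  proof (cases "A = {w}")
    case False
    then obtain z where z: "z \<in> A" "z \<noteq> w" using psubset.prems by auto
    then obtain n where n: "prefix n z \<noteq> prefix n w" using prefix_separates by blast
    let ?Z = "A \<inter> {y \<in> X. prefix n y = prefix n w}"
    have "?Z \<subset> A" using z n by auto
    moreover have "?Z \<in> bool_alg X" using psubset.prems by (intro bool_alg.Int prefix_eq_in_bool_alg)
    moreover have "w \<in> ?Z" using psubset.prems bool_alg_subset by auto
    ultimately show ?thesis using psubset.IH by blast
  qed (use psubset.prems in simp)
qed

text \<open>On this set the summands with two empty words have the same total coefficient as at
  \<open>w\<close>, so their contribution is a constant multiple of the identity.\<close>

lemma same_side_in_bool_alg:
  "normal l \<Longrightarrow> {v \<in> X. \<forall>(c, \<alpha>, A, \<beta>)\<in>set l. \<alpha> = [] \<and> \<beta> = [] \<longrightarrow> (v \<in> A \<longleftrightarrow> w \<in> A)} \<in> bool_alg X"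
proof (induction l)
  case Nil
  show ?case by simp
next
  case (Cons t l)
  obtain c \<alpha> A \<beta> where t: "t = (c, \<alpha>, A, \<beta>)" by (cases t)
  have A: "A \<in> bool_alg X" and l: "normal l" using Cons.prems t by (auto simp: canonical_def)
  have "{v \<in> X. \<forall>(c, \<alpha>, A, \<beta>)\<in>set (t # l). \<alpha> = [] \<and> \<beta> = [] \<longrightarrow> (v \<in> A \<longleftrightarrow> w \<in> A)} =
    {v \<in> X. \<forall>(c, \<alpha>, A, \<beta>)\<in>set l. \<alpha> = [] \<and> \<beta> = [] \<longrightarrow> (v \<in> A \<longleftrightarrow> w \<in> A)} \<inter>
      (if \<alpha> = [] \<and> \<beta> = [] then if w \<in> A then A else X - A else X)"
    using bool_alg_subset[OF A] unfolding t by auto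
  also have "\<dots> \<in> bool_alg X" using Cons.IH[OF l] A by (intro bool_alg.Int) auto
  finally show ?case .
qed

text \<open>In a reduced pair that is not trivial the words are distinct, so
  \<open>common_tail_unique\<close> leaves at most one fixed point for each of the finitely many
  summands.\<close>

lemma finite_exceptional:
  assumes "normal l"
  shows "finite (\<Union>(c, \<alpha>, A, \<beta>)\<in>set l. {v. \<not> (\<alpha> = [] \<and> \<beta> = []) \<and> (\<exists>u. v = \<alpha> \<frown> u \<and> v = \<beta> \<frown> u)})"
proof (intro finite_UN_I)
  fix t assume tl: "t \<in> set l"
  obtain c \<alpha> A \<beta> where t: "t = (c, \<alpha>, A, \<beta>)" by (cases t)
  have r: "reduced \<alpha> \<beta>" using normalD[OF assms] tl unfolding t canonical_def by blast
  define E where "E = {v. \<not> (\<alpha> = [] \<and> \<beta> = []) \<and> (\<exists>u. v = \<alpha> \<frown> u \<and> v = \<beta> \<frown> u)}"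
  have unique: "v = v'" if v: "v \<in> E" "v' \<in> E" for v v'
  proof -
    obtain u u' where u: "v = \<alpha> \<frown> u" "v = \<beta> \<frown> u" "v' = \<alpha> \<frown> u'" "v' = \<beta> \<frown> u'"
      using v unfolding E_def by blast
    have "\<alpha> \<noteq> \<beta>" using r v unfolding reduced_def E_def by auto
    then have "u = u'" using common_tail_unique u by metis
    then show ?thesis using u by simp
  qed
  have "finite E"
  proof (cases "E = {}")
    case False
    then obtain v where "v \<in> E" by blast
    then have "E \<subseteq> {v}" using unique by blast
    then show ?thesis by (rule finite_subset) simp
  qed simp
  then show "finite (case t of (c, \<alpha>, A, \<beta>) \<Rightarrow> {v. \<not> (\<alpha> = [] \<and> \<beta> = []) \<and> (\<exists>u. v = \<alpha> \<frown> u \<and> v = \<beta> \<frown> u)})"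
    unfolding t E_def by simp
qed simp

text \<open>With a second point \<open>z'\<close> in \<open>A\<close>, a cylinder around
  \<open>z\<close> avoiding \<open>z'\<close> cuts \<open>b\<close> to a nonzero element that kills
  the point mass at \<open>z'\<close>. All its left multiples kill it too, but \<open>b\<close> does
  not.\<close>

lemma left_simple_scalar_imp_singleton:
  assumes ls: "B.left_simple b" and A: "A \<in> bool_alg X" and z: "z \<in> A" and "c \<noteq> 0"
    and b: "\<And>\<phi> x k. \<rho> b \<phi> x k = (if x \<in> A then c * \<phi> x k else 0)"
  shows "A = {z}"
proof (rule ccontr)
  assume "A \<noteq> {z}"
  then obtain z' where z': "z' \<in> A" "z' \<noteq> z" using z by auto
  then obtain n where n: "prefix n z' \<noteq> prefix n z" using prefix_separates by blast
  have bB: "b \<in> carrier B" using ls unfolding B.left_simple_def by auto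
  let ?Z = "{y \<in> X. prefix n y = prefix n z}"
  let ?d = "proj R X ?Z"
  have U: "?Z \<in> bool_alg X" by (rule prefix_eq_in_bool_alg)
  then have d: "?d \<in> carrier B" by auto
  have zX: "z \<in> X" using z A bool_alg_subset by auto
  have "\<rho> (?d \<otimes>\<^bsub>B\<^esub> b) (delta z 0) z 0 \<noteq> 0"
    using d bB U z zX \<open>c \<noteq> 0\<close> by (simp add: \<rho>_mult \<rho>_proj b delta_def)
  then have "?d \<otimes>\<^bsub>B\<^esub> b \<noteq> \<zero>\<^bsub>B\<^esub>" by (auto simp: \<rho>_zero)
  then obtain e where e: "e \<in> carrier B" "e \<otimes>\<^bsub>B\<^esub> (?d \<otimes>\<^bsub>B\<^esub> b) = b"
    using ls d unfolding B.left_simple_def by blast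
  have "\<rho> (?d \<otimes>\<^bsub>B\<^esub> b) (delta z' 0) = (\<lambda>x k. 0)"
    using d bB U n by (intro ext) (auto simp: \<rho>_mult \<rho>_proj b delta_def)
  then have "\<rho> (e \<otimes>\<^bsub>B\<^esub> (?d \<otimes>\<^bsub>B\<^esub> b)) (delta z' 0) = (\<lambda>x k. 0)"
    using e(1) d bB by (simp add: \<rho>_mult[of e] \<rho>_zero_arg)
  then have "\<rho> b (delta z' 0) z' 0 = 0" unfolding e(2) by simp
  then show False using z' \<open>c \<noteq> 0\<close> by (simp add: b delta_def)
qed

lemma left_simple_isolated_point:
  assumes ls: "B.left_simple b" and nz: "\<rho> b (delta w 0) w 0 \<noteq> 0"
  obtains z where "{z} \<in> bool_alg X" and "\<rho> b (delta z 0) z 0 \<noteq> 0"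
proof -
  have bB: "b \<in> carrier B" using ls unfolding B.left_simple_def by auto
  have wX: "w \<in> X" using \<rho>_delta_nonzero[OF bB nz] by metis
  obtain l where l: "normal l" "\<And>\<phi> x k. \<rho> b \<phi> x k = opsum l \<phi> x k" using \<rho>_opsum[OF bB] by metis
  \<comment> \<open>The diagonal entry at \<open>w\<close> comes from the summands with two empty
    words: another pair may return to \<open>w\<close>, but only with a change of degree.\<close>
  define c0 where "c0 = (\<Sum>(c, \<alpha>, A, \<beta>)\<leftarrow>l. if \<alpha> = [] \<and> \<beta> = [] \<and> w \<in> A then c else 0)"
  have c0: "\<rho> b (delta w 0) w 0 = c0"
    using opsum_germ[OF l(1), of "[]" "[]" w] unfolding c0_def by (simp add: l(2) reduced_def)
  define A where "A = {v \<in> X. \<forall>(c, \<alpha>, A, \<beta>)\<in>set l. \<alpha> = [] \<and> \<beta> = [] \<longrightarrow> (v \<in> A \<longleftrightarrow> w \<in> A)}"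
  have AU: "A \<in> bool_alg X" unfolding A_def by (rule same_side_in_bool_alg[OF l(1)])
  have wA: "w \<in> A" unfolding A_def using wX by auto
  define E where "E = (\<Union>(c, \<alpha>, A, \<beta>)\<in>set l. {v. \<not> (\<alpha> = [] \<and> \<beta> = []) \<and> (\<exists>u. v = \<alpha> \<frown> u \<and> v = \<beta> \<frown> u)})"
  have finE: "finite E" unfolding E_def by (rule finite_exceptional[OF l(1)])
  show thesis
  \<comment> \<open>If \<open>A\<close> has only exceptional points, it is finite and
    \<open>w\<close> itself is isolated. Otherwise a point \<open>z\<close> of \<open>A\<close>
    outside \<open>E\<close> can be surrounded by a cylinder that eliminates all nontrivial
    pairs.\<close>
  proof (cases "A \<subseteq> E")
    case True
    then have "{w} \<in> bool_alg X" using point_of_finite_in_bool_alg AU wA finE finite_subset by metis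
    then show thesis using that nz by blast
  next
    case False
    then obtain z where z: "z \<in> A" "z \<notin> E" by auto
    \<comment> \<open>Each summand needs a sufficiently long prefix; phrased as an eventual
      property, the finitely many requirements are met by one \<open>n\<close>.\<close>
    have "\<forall>t\<in>set l. \<forall>\<^sub>F n in sequentially. case t of (c, \<alpha>, A, \<beta>) \<Rightarrow> \<not> (\<alpha> = [] \<and> \<beta> = []) \<longrightarrow>
        (\<forall>w. \<not> (prefix n (\<alpha> \<frown> w) = prefix n z \<and> prefix n (\<beta> \<frown> w) = prefix n z))"
    proof
      fix t assume t: "t \<in> set l"
      obtain c \<alpha> A \<beta> where t': "t = (c, \<alpha>, A, \<beta>)" by (cases t)
      show "\<forall>\<^sub>F n in sequentially. case t of (c, \<alpha>, A, \<beta>) \<Rightarrow> \<not> (\<alpha> = [] \<and> \<beta> = []) \<longrightarrow>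
        (\<forall>w. \<not> (prefix n (\<alpha> \<frown> w) = prefix n z \<and> prefix n (\<beta> \<frown> w) = prefix n z))"
      proof (cases "\<alpha> = [] \<and> \<beta> = []")
        case False
        then have "\<nexists>u. z = \<alpha> \<frown> u \<and> z = \<beta> \<frown> u" using z(2) t t' unfolding E_def by fastforce
        then have "\<exists>N. \<forall>n\<ge>N. \<forall>w. \<not> (prefix n (\<alpha> \<frown> w) = prefix n z \<and> prefix n (\<beta> \<frown> w) = prefix n z)"
          by (rule cylinder_separates)
        then show ?thesis unfolding t' eventually_sequentially prod.case by blast
      qed (simp add: t')
    qed
    then have "\<forall>\<^sub>F n in sequentially. \<forall>t\<in>set l. case t of (c, \<alpha>, A, \<beta>) \<Rightarrow> \<not> (\<alpha> = [] \<and> \<beta> = []) \<longrightarrow>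
        (\<forall>w. \<not> (prefix n (\<alpha> \<frown> w) = prefix n z \<and> prefix n (\<beta> \<frown> w) = prefix n z))"
      by (intro eventually_ball_finite) auto
    then obtain n where "\<forall>t\<in>set l. case t of (c, \<alpha>, A, \<beta>) \<Rightarrow> \<not> (\<alpha> = [] \<and> \<beta> = []) \<longrightarrow>
        (\<forall>w. \<not> (prefix n (\<alpha> \<frown> w) = prefix n z \<and> prefix n (\<beta> \<frown> w) = prefix n z))"
      using eventually_happens'[OF sequentially_bot] by blast
    then have n: "\<And>c \<alpha> A \<beta> w. (c, \<alpha>, A, \<beta>) \<in> set l \<Longrightarrow> \<not> (\<alpha> = [] \<and> \<beta> = []) \<Longrightarrow>
        \<not> (prefix n (\<alpha> \<frown> w) = prefix n z \<and> prefix n (\<beta> \<frown> w) = prefix n z)"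
      by blast
    define Z where "Z = A \<inter> {y \<in> X. prefix n y = prefix n z}"
    have ZU: "Z \<in> bool_alg X" unfolding Z_def using AU by (intro bool_alg.Int prefix_eq_in_bool_alg)
    have zZ: "z \<in> Z" unfolding Z_def using z AU bool_alg_subset by auto
    let ?P = "proj R X Z"
    have P: "?P \<in> carrier B" using ZU by auto
    \<comment> \<open>Nontrivial pairs take no point of \<open>Z\<close> back into \<open>Z\<close>,
      and trivial pairs see every point of \<open>Z\<close> on the same side as \<open>w\<close>, so
      the coefficient is \<open>c0\<close> throughout.\<close>
    have diag: "opsum l (\<lambda>x k. if x \<in> Z then \<phi> x k else 0) x k = c0 * \<phi> x k" if x: "x \<in> Z" for \<phi> x k
    proof -
      have "opsum l' (\<lambda>x k. if x \<in> Z then \<phi> x k else 0) x k =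
          (\<Sum>(c, \<alpha>, A, \<beta>)\<leftarrow>l'. if \<alpha> = [] \<and> \<beta> = [] \<and> w \<in> A then c else 0) * \<phi> x k"
        if "set l' \<subseteq> set l" for l'
        using that
      proof (induction l')
        case (Cons t l')
        obtain c \<alpha> C \<beta> where t: "t = (c, \<alpha>, C, \<beta>)" by (cases t)
        then have tl: "(c, \<alpha>, C, \<beta>) \<in> set l" using Cons.prems by auto
        have "(if \<exists>w\<in>C. x = \<alpha> \<frown> w then c * (if \<beta> \<frown> suffix (length \<alpha>) x \<in> Z
            then \<phi> (\<beta> \<frown> suffix (length \<alpha>) x) (k - int (length \<alpha>) + int (length \<beta>)) else 0) else 0) =
            (if \<alpha> = [] \<and> \<beta> = [] \<and> w \<in> C then c else 0) * \<phi> x k"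
        proof (cases "\<alpha> = [] \<and> \<beta> = []")
          case True
          then have "x \<in> C \<longleftrightarrow> w \<in> C" using x tl unfolding Z_def A_def by fastforce
          then show ?thesis using True x by auto
        next
          case False
          have "\<beta> \<frown> u \<notin> Z" if "x = \<alpha> \<frown> u" for u
            using n[OF tl False, of u] x that unfolding Z_def by auto
          then show ?thesis using False by auto
        qed
        then show ?case using Cons unfolding t by (simp add: distrib_right del: build_append)
      qed simp
      then show ?thesis unfolding c0_def by blast
    qed
    let ?b = "?P \<otimes>\<^bsub>B\<^esub> b \<otimes>\<^bsub>B\<^esub> ?P"
    have "\<rho> ?b \<phi> x k = (if x \<in> Z then c0 * \<phi> x k else 0)" for \<phi> x k
      using P bB ZU diag by (simp add: \<rho>_mult \<rho>_proj l(2))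
    moreover have "B.left_simple ?b" by (rule B.left_simple_mult[OF ls P P])
    ultimately have Z: "Z = {z}"
      using left_simple_scalar_imp_singleton ZU zZ nz c0 by metis
    have "(\<lambda>x k. if x \<in> Z then delta z 0 x k else 0) = delta z 0"
      unfolding Z by (auto simp: delta_def fun_eq_iff)
    then have "\<rho> b (delta z 0) z 0 = c0"
      using diag[OF zZ, of "delta z 0" 0] by (simp add: l(2)) (simp add: delta_def)
    then show thesis using that[of z] ZU Z nz c0 by simp
  qed
qed

text \<open>A summand that returns to \<open>z\<close> contributes \<open>c\<close> times the power
  with exponent \<open>length \<alpha> - length \<beta>\<close>, since it only translates the
  degree; all others contribute zero. Composition at \<open>z\<close> thus becomes multiplication of
  Laurent polynomials.\<close>

lemma laurent_symbol:
  assumes "a \<in> carrier B"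
  obtains G :: "int \<Rightarrow>\<^sub>0 'r" where
    "\<And>h k. \<rho> a (\<lambda>x k. if x = z then Poly_Mapping.lookup h k else 0) z k = Poly_Mapping.lookup (G * h) k"
proof -
  obtain l where l: "\<And>\<phi> x k. \<rho> a \<phi> x k = opsum l \<phi> x k" using \<rho>_opsum[OF assms] by metis
  have "\<exists>G :: int \<Rightarrow>\<^sub>0 'r. \<forall>h k. opsum l (\<lambda>x k. if x = z then Poly_Mapping.lookup h k else 0) z k
      = Poly_Mapping.lookup (G * h) k"
  proof (induction l)
    case Nil
    show ?case by (intro exI[of _ 0]) simp
  next
    case (Cons t l)
    then obtain G :: "int \<Rightarrow>\<^sub>0 'r" where
      G: "\<And>h k. opsum l (\<lambda>x k. if x = z then Poly_Mapping.lookup h k else 0) z k = Poly_Mapping.lookup (G * h) k"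
      by blast
    obtain c \<alpha> A \<beta> where t: "t = (c, \<alpha>, A, \<beta>)" by (cases t)
    let ?H = "if (\<exists>w\<in>A. z = \<alpha> \<frown> w) \<and> \<beta> \<frown> suffix (length \<alpha>) z = z
      then Poly_Mapping.single (int (length \<alpha>) - int (length \<beta>)) c else 0"
    have "opsum (t # l) (\<lambda>x k. if x = z then Poly_Mapping.lookup h k else 0) z k
        = Poly_Mapping.lookup ((?H + G) * h) k" for h k
      unfolding t opsum_simps G
      by (auto simp: distrib_right lookup_add lookup_single_mult diff_diff_eq2 diff_add_eq simp del: build_append)
    then show ?case by blast
  qed
  then show thesis using that l by metis
qed

text \<open>Left simplicity passes to the compression of \<open>b\<close> at \<open>z\<close>. At an
  eventually periodic \<open>z\<close> the algebra contains an element acting there as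
  \<open>1 - t^n\<close>, and recovering the compression from its product with this element would
  invert a non-unit.\<close>

lemma left_simple_point_in_QX:
  assumes ls: "B.left_simple b" and z: "{z} \<in> bool_alg X" and nz: "\<rho> b (delta z 0) z 0 \<noteq> 0"
  shows "z \<in> QX X"
proof (rule ccontr)
  assume "z \<notin> QX X"
  then obtain \<alpha> \<beta> where per: "\<beta> \<noteq> []" "z = \<alpha> \<frown> \<beta>\<^sup>\<omega>" using z unfolding QX_def by auto
  \<comment> \<open>Unrolling one period presents \<open>z\<close> with two prefixes before the same
    tail; their lengths differ by \<open>length \<beta>\<close>, the exponent used below.\<close>
  have z2: "z = (\<alpha> @ \<beta>) \<frown> \<beta>\<^sup>\<omega>" using per iter_unroll[of \<beta>] by (metis conc_conc length_greater_0_conv)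
  have zX: "z \<in> X" using point_in_X[OF z] .
  have bB: "b \<in> carrier B" using ls unfolding B.left_simple_def by auto
  let ?P = "proj R X {z}"
  let ?\<phi> = "\<lambda>h. (\<lambda>x k. if x = z then Poly_Mapping.lookup h k else 0) :: ('a, 'r) graded_fun"
  have P: "?P \<in> carrier B" using z by auto
  define b' where "b' = ?P \<otimes>\<^bsub>B\<^esub> b \<otimes>\<^bsub>B\<^esub> ?P"
  have b': "b' \<in> carrier B" unfolding b'_def using P bB by auto
  have ls': "B.left_simple b'" unfolding b'_def by (rule B.left_simple_mult[OF ls P P])
  obtain Gb :: "int \<Rightarrow>\<^sub>0 'r" where Gb: "\<And>h k. \<rho> b (?\<phi> h) z k = Poly_Mapping.lookup (Gb * h) k"
    using laurent_symbol[OF bB] by metis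
  have restr: "(\<lambda>x k. if x = z then ?\<phi> h x k else 0) = ?\<phi> h" for h by (auto simp: fun_eq_iff)
  have \<rho>b': "\<rho> b' (?\<phi> h) = ?\<phi> (Gb * h)" for h
    unfolding b'_def using P bB z Gb by (intro ext) (simp add: \<rho>_mult \<rho>_proj restr)
  \<comment> \<open>The constant polynomial \<open>1\<close> is the point mass in degree zero, so
    the hypothesis on the diagonal entry says that \<open>Gb\<close> has a nonzero constant
    coefficient.\<close>
  have "?\<phi> 1 = delta z 0" by (auto simp: delta_def fun_eq_iff lookup_one when_def)
  then have "Poly_Mapping.lookup Gb 0 \<noteq> 0" using nz Gb[of 1 0] by simp
  then have "Gb \<noteq> 0" by auto
  define n where "n = int (length \<beta>)"
  have "n > 0" using per unfolding n_def by simp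
  let ?t = "Poly_Mapping.single n (1::'r)"
  \<comment> \<open>Inserting one period at \<open>z\<close> raises the degree by \<open>n\<close>,
    so \<open>d\<close> acts at \<open>z\<close> as multiplication by \<open>1 - ?t\<close>.\<close>
  define d where "d = ?P \<oplus>\<^bsub>B\<^esub> scalar (- 1) \<otimes>\<^bsub>B\<^esub> (?P \<otimes>\<^bsub>B\<^esub> move (\<alpha> @ \<beta>) \<alpha>)"
  have d: "d \<in> carrier B" unfolding d_def using P by auto
  have mv: "\<rho> (move (\<alpha> @ \<beta>) \<alpha>) (?\<phi> h) z k = Poly_Mapping.lookup h (k - n)" for h k
    using \<rho>_move_conc[of "\<alpha> @ \<beta>" "\<beta>\<^sup>\<omega>" \<alpha> "?\<phi> h" k] zX unfolding z2[symmetric] per(2)[symmetric] n_def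
    by (simp add: algebra_simps)
  have \<rho>d: "\<rho> d (?\<phi> h) = ?\<phi> ((1 - ?t) * h)" for h
    unfolding d_def using P z zX mv
    by (intro ext) (auto simp: \<rho>_add \<rho>_mult \<rho>_proj \<rho>_scalar left_diff_distrib lookup_minus lookup_single_mult)
  have \<rho>db': "\<rho> (d \<otimes>\<^bsub>B\<^esub> b') (?\<phi> 1) = ?\<phi> ((1 - ?t) * Gb)"
    using d b' \<rho>b'[of 1, unfolded mult_1_right] \<rho>d[of Gb] by (simp add: \<rho>_mult)
  have "?t \<noteq> 1"
    using \<open>n > 0\<close> by (metis lookup_one lookup_single_eq less_irrefl when_simps(2) zero_neq_one)
  then have "(1 - ?t) * Gb \<noteq> 0" using \<open>Gb \<noteq> 0\<close> by simp
  then obtain k where "Poly_Mapping.lookup ((1 - ?t) * Gb) k \<noteq> 0" by (metis lookup_zero poly_mapping_eqI)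
  then have "\<rho> (d \<otimes>\<^bsub>B\<^esub> b') (?\<phi> 1) z k \<noteq> 0" unfolding \<rho>db' by simp
  then have "d \<otimes>\<^bsub>B\<^esub> b' \<noteq> \<zero>\<^bsub>B\<^esub>" by (auto simp: \<rho>_zero)
  then obtain e where e: "e \<in> carrier B" "e \<otimes>\<^bsub>B\<^esub> (d \<otimes>\<^bsub>B\<^esub> b') = b'"
    using ls' d unfolding B.left_simple_def by blast
  obtain Ge :: "int \<Rightarrow>\<^sub>0 'r" where Ge: "\<And>h k. \<rho> e (?\<phi> h) z k = Poly_Mapping.lookup (Ge * h) k"
    using laurent_symbol[OF e(1)] by metis
  have "\<rho> (e \<otimes>\<^bsub>B\<^esub> (d \<otimes>\<^bsub>B\<^esub> b')) (?\<phi> 1) z k = \<rho> b' (?\<phi> 1) z k" for k unfolding e(2) ..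
  moreover have "\<rho> (e \<otimes>\<^bsub>B\<^esub> (d \<otimes>\<^bsub>B\<^esub> b')) (?\<phi> 1) z k = Poly_Mapping.lookup (Ge * ((1 - ?t) * Gb)) k" for k
    using e(1) d b' \<rho>db' Ge by (simp add: \<rho>_mult[of e])
  moreover have "\<rho> b' (?\<phi> 1) z k = Poly_Mapping.lookup Gb k" for k
    using \<rho>b'[of 1] by simp
  ultimately have "Ge * ((1 - ?t) * Gb) = Gb" by (intro poly_mapping_eqI) simp
  \<comment> \<open>Laurent polynomials over a field form an integral domain, so the nonzero
    \<open>Gb\<close> can be cancelled and \<open>1 - ?t\<close> gets an inverse.\<close>
  then have "(Ge * (1 - ?t)) * Gb = 1 * Gb" by (simp add: mult.assoc)
  then have "Ge * (1 - ?t) = 1" using \<open>Gb \<noteq> 0\<close> mult_right_cancel by blast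
  then show False using one_minus_single_not_unit[OF \<open>n > 0\<close>] by blast
qed

lemma left_simple_in_point_ideal:
  assumes ls: "B.left_simple x" and nz: "x \<noteq> \<zero>\<^bsub>B\<^esub>"
  obtains q where "q \<in> QX X" and "x \<in> point_ideal R X q"
proof -
  have x: "x \<in> carrier B" using ls unfolding B.left_simple_def by auto
  obtain y v k where yvk: "\<rho> x (delta y 0) v k \<noteq> 0" using \<rho>_eq_zero[OF x] nz by blast
  then obtain \<alpha> \<beta> w where w: "v = \<alpha> \<frown> w" "y = \<beta> \<frown> w" "k = int (length \<alpha>) - int (length \<beta>)" "v \<in> X" "y \<in> X"
    using \<rho>_delta_nonzero[OF x] by metis
  have wX: "w \<in> X" using w conc_tail by metis
  let ?a = "move [] \<alpha>" and ?c = "move \<beta> []"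
  define b where "b = ?a \<otimes>\<^bsub>B\<^esub> x \<otimes>\<^bsub>B\<^esub> ?c"
  \<comment> \<open>Prepending \<open>\<beta>\<close> carries \<open>w\<close> to \<open>y\<close>
    but also to degree \<open>length \<beta>\<close>; \<open>\<rho>_shift\<close> then compares with
    the entry taken in degree zero.\<close>
  have "\<rho> ?c (delta w 0) = (\<lambda>x k. delta y 0 x (k + - int (length \<beta>)))"
  proof (intro ext)
    fix x k
    have "x = y \<longleftrightarrow> prefix (length \<beta>) x = \<beta> \<and> suffix (length \<beta>) x = w"
      unfolding w(2) by (metis prefix_conc_length prefix_suffix suffix_conc_length)
    then show "\<rho> ?c (delta w 0) x k = delta y 0 x (k + - int (length \<beta>))"
      using w(5) wX by (auto simp: \<rho>_move delta_def)
  qed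
  then have "\<rho> b (delta w 0) w 0 = \<rho> x (\<lambda>x k. delta y 0 x (k + - int (length \<beta>))) (\<alpha> \<frown> w) (int (length \<alpha>))"
    unfolding b_def using x w wX \<rho>_move_conc[of "[]" w \<alpha>] by (simp add: \<rho>_mult)
  also have "\<dots> = \<rho> x (delta y 0) v k" using \<rho>_shift[OF x, of "delta y 0" "- int (length \<beta>)" v "int (length \<alpha>)"] w(1,3) by simp
  finally have "\<rho> b (delta w 0) w 0 \<noteq> 0" using yvk by simp
  moreover have lsb: "B.left_simple b" unfolding b_def by (rule B.left_simple_mult[OF ls]) auto
  ultimately obtain q where q: "{q} \<in> bool_alg X" and bq: "\<rho> b (delta q 0) q 0 \<noteq> 0"
    using left_simple_isolated_point by blast
  have QX: "q \<in> QX X" using left_simple_point_in_QX[OF lsb q bq] .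
  let ?P = "proj R X {q}"
  have P: "?P \<in> carrier B" using q by auto
  \<comment> \<open>The nonzero diagonal entry of \<open>b\<close> at \<open>q\<close> is read off
    after cutting with \<open>?P\<close>. So left simplicity of \<open>x\<close> itself makes
    \<open>x\<close> a left multiple of a product containing \<open>?P\<close>.\<close>
  have "(?P \<otimes>\<^bsub>B\<^esub> ?a) \<otimes>\<^bsub>B\<^esub> x \<noteq> \<zero>\<^bsub>B\<^esub>"
  proof
    assume "(?P \<otimes>\<^bsub>B\<^esub> ?a) \<otimes>\<^bsub>B\<^esub> x = \<zero>\<^bsub>B\<^esub>"
    then have "\<rho> ((?P \<otimes>\<^bsub>B\<^esub> ?a) \<otimes>\<^bsub>B\<^esub> x) (\<rho> ?c (delta q 0)) q 0 = 0" by (simp add: \<rho>_zero)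
    then show False using bq x P q unfolding b_def by (simp add: \<rho>_mult \<rho>_proj)
  qed
  then obtain e where e: "e \<in> carrier B" "e \<otimes>\<^bsub>B\<^esub> ((?P \<otimes>\<^bsub>B\<^esub> ?a) \<otimes>\<^bsub>B\<^esub> x) = x"
    using ls P unfolding B.left_simple_def by blast
  interpret J: ideal "point_ideal R X q" B
    unfolding point_ideal_def using q by (intro B.genideal_ideal) auto
  have "?P \<in> point_ideal R X q"
    unfolding point_ideal_def using q by (intro B.genideal_self') auto
  then have "e \<otimes>\<^bsub>B\<^esub> ((?P \<otimes>\<^bsub>B\<^esub> ?a) \<otimes>\<^bsub>B\<^esub> x) \<in> point_ideal R X q"
    using e x by (intro J.I_l_closed J.I_r_closed) auto
  then show thesis using that QX e by simp
qed

text \<open>The elements whose values vanish off the tail class of \<open>q\<close> form an ideal: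
  right factors change only the argument, and left factors stay within tail classes by
  \<open>\<rho>_tail_local\<close>.\<close>

lemma point_ideal_support:
  assumes q: "{q} \<in> bool_alg X" and b: "b \<in> point_ideal R X q" and "\<not> tail_equiv x q"
  shows "\<rho> b \<phi> x k = 0"
proof -
  let ?J = "{b \<in> carrier B. \<forall>\<phi> x k. \<not> tail_equiv x q \<longrightarrow> \<rho> b \<phi> x k = 0}"
  have "ideal ?J B"
  proof (rule idealI)
    show "ring B" by (rule B.ring_axioms)
    have neg: "\<rho> (\<ominus>\<^bsub>B\<^esub> a) \<phi> x k = - \<rho> a \<phi> x k" if "a \<in> carrier B" for a \<phi> x k
    proof -
      have "\<rho> (a \<oplus>\<^bsub>B\<^esub> \<ominus>\<^bsub>B\<^esub> a) \<phi> x k = 0" using that by (simp add: B.r_neg \<rho>_zero)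
      then show ?thesis using that by (simp add: \<rho>_add eq_neg_iff_add_eq_0 add.commute)
    qed
    show "subgroup ?J (add_monoid B)"
      by (rule B.add.subgroupI) (auto simp: \<rho>_zero \<rho>_add neg simp flip: a_inv_def)
    fix a c assume a: "a \<in> ?J" and c: "c \<in> carrier B"
    show "a \<otimes>\<^bsub>B\<^esub> c \<in> ?J" using a c by (auto simp: \<rho>_mult)
    have "\<rho> c (\<rho> a \<phi>) x k = 0" if "\<not> tail_equiv x q" for \<phi> x k
    proof (rule \<rho>_tail_local[OF c])
      fix y k assume "tail_equiv x y"
      then have "\<not> tail_equiv y q" using that tail_equiv_trans by blast
      then show "\<rho> a \<phi> y k = 0" using a by blast
    qed
    then show "c \<otimes>\<^bsub>B\<^esub> a \<in> ?J" using a c by (auto simp: \<rho>_mult)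
  qed
  moreover have "proj R X {q} \<in> ?J" using q tail_equiv_refl by (auto simp: \<rho>_proj)
  ultimately have "point_ideal R X q \<subseteq> ?J"
    unfolding point_ideal_def by (intro B.genideal_minimal) auto
  then show ?thesis using b assms(3) by blast
qed

lemma \<rho>_finsum:
  assumes "finite F'" and "f \<in> F' \<rightarrow> carrier B"
  shows "\<rho> (finsum B f F') \<phi> x k = (\<Sum>i\<in>F'. \<rho> (f i) \<phi> x k)"
  using assms
proof (induction F' rule: finite_induct)
  case (insert i F')
  then have fi: "f i \<in> carrier B" "f \<in> F' \<rightarrow> carrier B" by auto
  then show ?case using insert by (simp add: B.finsum_insert \<rho>_add)
qed (simp add: \<rho>_zero)

section \<open>Tail classes and the direct sum\<close>

lemma QX_point: "q \<in> QX X \<Longrightarrow> {q} \<in> bool_alg X"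
  by (simp add: QX_def)

lemma equiv_tail: "equiv (QX X) {(x, y). x \<in> QX X \<and> y \<in> QX X \<and> tail_equiv x y}"
  by (rule equivI) (auto simp: refl_on_def sym_def trans_def
      intro: tail_equiv_refl tail_equiv_sym tail_equiv_trans)

lemma class_members:
  assumes "c \<in> QX_classes X" and "q \<in> c"
  shows "q \<in> QX X" and "q' \<in> c \<longleftrightarrow> q' \<in> QX X \<and> tail_equiv q q'"
proof -
  let ?r = "{(x, y). x \<in> QX X \<and> y \<in> QX X \<and> tail_equiv x y}"
  have c: "c \<in> QX X // ?r" using assms(1) unfolding QX_classes_def .
  then show q: "q \<in> QX X" using assms(2) in_quotient_imp_subset[OF equiv_tail] by blast
  have "c = ?r `` {q}"
    using c assms(2) q quotient_eq_iff[OF equiv_tail c quotientI[of q "QX X" ?r], of q q] tail_equiv_refl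
    by auto
  then show "q' \<in> c \<longleftrightarrow> q' \<in> QX X \<and> tail_equiv q q'" using q by auto
qed

lemma point_ideal_eq_on_class:
  assumes "c \<in> QX_classes X" "q \<in> c" "q' \<in> c"
  shows "point_ideal R X q = point_ideal R X q'"
  using class_members[OF assms(1,2)] class_members[OF assms(1,3)] assms
  by (intro equalityI point_ideal_mono) (auto simp: QX_point)

lemma class_ideal_eq:
  assumes "c \<in> QX_classes X" "q \<in> c"
  shows "class_ideal R X c = point_ideal R X q"
  unfolding class_ideal_def using assms someI[of "\<lambda>q. q \<in> c" q]
  by (intro point_ideal_eq_on_class) auto

lemma class_nonempty: "c \<in> QX_classes X \<Longrightarrow> \<exists>q. q \<in> c"
  unfolding QX_classes_def using in_quotient_imp_non_empty[OF equiv_tail] by blast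

lemma QX_in_class: "q \<in> QX X \<Longrightarrow> \<exists>c\<in>QX_classes X. q \<in> c"
  unfolding QX_classes_def
  using equiv_class_self[OF equiv_tail] quotientI[of q "QX X"] by blast

lemma ideal_point_ideal: "{q} \<in> bool_alg X \<Longrightarrow> ideal (point_ideal R X q) B"
  unfolding point_ideal_def by (intro B.genideal_ideal) auto

lemma ideal_class_ideal: "c \<in> QX_classes X \<Longrightarrow> ideal (class_ideal R X c) B"
  using class_nonempty class_ideal_eq class_members(1) ideal_point_ideal QX_point by metis

text \<open>Both inclusions go through left simple elements: each nonzero one lies in a single point
  ideal, and since the socle is two-sided it contains a class ideal as soon as it contains the
  projection of one representative.\<close>

lemma socle_eq_family_sum: "socle B = family_sum B (QX_classes X) (class_ideal R X)"
proof
  have sub: "additive_subgroup (class_ideal R X c) B" if "c \<in> QX_classes X" for c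
    using ideal_class_ideal[OF that] by (rule ideal.axioms(1))
  have fs: "additive_subgroup (family_sum B (QX_classes X) (class_ideal R X)) B"
    by (rule B.additive_subgroup_family_sum[OF sub])
  show "socle B \<subseteq> family_sum B (QX_classes X) (class_ideal R X)"
  proof (rule B.socle_least[OF fs])
    fix x assume ls: "B.left_simple x"
    show "x \<in> family_sum B (QX_classes X) (class_ideal R X)"
    proof (cases "x = \<zero>\<^bsub>B\<^esub>")
      case True
      then show ?thesis using additive_subgroup.zero_closed[OF fs] by simp
    next
      case False
      then obtain q where q: "q \<in> QX X" "x \<in> point_ideal R X q"
        using left_simple_in_point_ideal ls by metis
      then obtain c where c: "c \<in> QX_classes X" "q \<in> c" using QX_in_class by blast
      then show ?thesis
        using q class_ideal_eq[OF c] additive_subgroup.a_subset[OF sub[OF c(1)]]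
        by (intro B.family_sum_member[of c]) auto
    qed
  qed
  show "family_sum B (QX_classes X) (class_ideal R X) \<subseteq> socle B"
  proof (rule B.family_sum_least)
    show "additive_subgroup (socle B) B" using B.ideal_socle by (rule ideal.axioms(1))
    fix c assume c: "c \<in> QX_classes X"
    then obtain q where q: "q \<in> c" using class_nonempty by blast
    have "proj R X {q} \<in> socle B"
      using class_members(1)[OF c q] by (intro B.left_simple_in_socle left_simple_proj_QX)
    then show "class_ideal R X c \<subseteq> socle B"
      unfolding class_ideal_eq[OF c q] point_ideal_def
      by (intro B.genideal_minimal B.ideal_socle) auto
  qed
qed

text \<open>Evaluate the vanishing sum at a point in the tail class belonging to \<open>c\<close>:
  every other summand is zero there, hence so is \<open>f c\<close>. Off that class
  \<open>f c\<close> vanishes by its support.\<close>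

lemma class_ideals_independent:
  assumes F': "finite F'" "F' \<subseteq> QX_classes X" and f: "f \<in> Pi F' (class_ideal R X)"
    and zero: "finsum B f F' = \<zero>\<^bsub>B\<^esub>" and c: "c \<in> F'"
  shows "f c = \<zero>\<^bsub>B\<^esub>"
proof -
  have fB: "f i \<in> carrier B" if "i \<in> F'" for i
    using that f F' ideal.Icarr[OF ideal_class_ideal] by blast
  have supp: "\<rho> (f i) \<phi> x k = 0" if "i \<in> F'" "q \<in> i" "\<not> tail_equiv x q" for i q \<phi> x k
    using that f F' class_ideal_eq[of i q] class_members(1)[of i q] QX_point
    by (intro point_ideal_support[of q]) blast+
  obtain q where q: "q \<in> c" using class_nonempty c F' by blast
  show ?thesis
  proof (rule \<rho>_eq_zero[OF fB[OF c]])
    fix y x k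
    show "\<rho> (f c) (delta y 0) x k = 0"
    proof (cases "tail_equiv x q")
      case False
      then show ?thesis using supp[OF c q] by blast
    next
      case True
      have "\<rho> (f i) (delta y 0) x k = 0" if i: "i \<in> F'" "i \<noteq> c" for i
      proof -
        obtain q' where q': "q' \<in> i" using class_nonempty i F' by blast
        have "\<not> tail_equiv q q'"
        proof
          assume *: "tail_equiv q q'"
          have iF: "i \<in> QX_classes X" and cF: "c \<in> QX_classes X" using i c F' by auto
          have "u \<in> i \<longleftrightarrow> u \<in> c" for u
            using class_members(2)[OF iF q', of u] class_members(2)[OF cF q, of u] *
              tail_equiv_trans tail_equiv_sym by blast
          then show False using i(2) by blast
        qed
        then have "\<not> tail_equiv x q'" using True tail_equiv_sym tail_equiv_trans by blast
        then show ?thesis using supp[OF i(1) q'] by blast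
      qed
      then have "(\<Sum>i\<in>F'. \<rho> (f i) (delta y 0) x k) = \<rho> (f c) (delta y 0) x k"
        using F'(1) c by (simp add: sum.remove[of F' c])
      moreover have "(\<Sum>i\<in>F'. \<rho> (f i) (delta y 0) x k) = 0"
        using \<rho>_finsum[OF F'(1), of f "delta y 0" x k] fB zero by (simp add: \<rho>_zero)
      ultimately show ?thesis by simp
    qed
  qed
qed

end

theorem corollary4p9:
  fixes X :: "(nat \<Rightarrow> 'a) set" and R :: "'r::field itself"
  assumes "subshift X"
    and "\<forall>a. \<exists>x\<in>X. a \<in> range x"
  shows "(\<forall>c\<in>QX_classes X. \<forall>q\<in>c. \<forall>q'\<in>c. point_ideal R X q = point_ideal R X q') \<and>
    internal_direct_sum (subshift_algebra R X) (QX_classes X) (class_ideal R X)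
      (socle (subshift_algebra R X))"
proof -
  interpret letter_subshift_algebra X R
    using assms by unfold_locales
  have "\<forall>c\<in>QX_classes X. \<forall>q\<in>c. \<forall>q'\<in>c. point_ideal R X q = point_ideal R X q'"
    using point_ideal_eq_on_class by blast
  moreover have "\<forall>c\<in>QX_classes X. ideal (class_ideal R X c) B"
    using ideal_class_ideal by blast
  moreover have "\<forall>f F. finite F \<and> F \<subseteq> QX_classes X \<and> f \<in> Pi F (class_ideal R X) \<and>
      finsum B f F = \<zero>\<^bsub>B\<^esub> \<longrightarrow> (\<forall>i\<in>F. f i = \<zero>\<^bsub>B\<^esub>)"
    by (intro allI impI ballI, elim conjE) (rule class_ideals_independent)
  ultimately show ?thesis
    unfolding internal_direct_sum_def using socle_eq_family_sum by (intro conjI)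
qed

end
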